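(* Let $D\in\mathcal S_{\overline{\mathbb Q}}$ be a polynomial of degree $2d$, let $\mathbb K_D$ be the number field generated over $\mathbb Q$ by the coefficients of $D$ and by a square root of its leading coefficient, and let $(p_n/q_n)_{n\ge0}$ be the convergents of $\sqrt D$. Then there is a finite set $E$ of discrete valuations of $\mathbb K_D$ such that for every discrete valuation $\nu$ of $\mathbb K_D$ not in $E$, every uniformizing parameter $\pi$ of $\nu$, every integer $r\ge d$ and every $\lambda\in\overline{\mathbb Q}$ with $\lambda^r=1/\pi$ (i.e. $\lambda=\zeta_r\sqrt[r]{1/\pi}$ with $\zeta_r$ an $r$-th root of unity), one has $q_n(\lambda)\neq0$ for every $n\ge0$.
   Context: $\overline{\mathbb Q}$ is an algebraic closure of $\mathbb Q$; $\mathcal S_{\overline{\mathbb Q}}$ is the set of polynomials in $\overline{\mathbb Q}[T]$ of positive even degree which are not squares in $\overline{\mathbb Q}[T]$. For such $D$, $\sqrt D$ denotes a square root of $D$ in the field of formal Laurent series $\mathbb K_D((T^{-1}))$ (either sign). For $\alpha=\sum_{i\le N}c_iT^i$ in $\mathbb K((T^{-1}))$, $\lfloor\alpha\rfloor=\sum_{i=0}^N c_iT^i$; the regular continued fraction of $\alpha$ is given by $\alpha_0=\alpha$, $a_n=\lfloor\alpha_n\rfloor$, $\alpha_{n+1}=1/(\alpha_n-a_n)$ (stopping if $\alpha_n$ is a polynomial). Its continuants are $p_{-2}=0,p_{-1}=1,q_{-2}=1,q_{-1}=0$, $p_n=a_np_{n-1}+p_{n-2}$, $q_n=a_nq_{n-1}+q_{n-2}$,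 and $p_n/q_n$ are the convergents. *)

theory Defs
  imports
    "HOL-Algebra.Algebraic_Closure_Type"
    "HOL-Algebra.Generated_Fields"
    "HOL-Computational_Algebra.Computational_Algebra"
    "HOL-Library.FuncSet"
begin

text \<open>
  The type \<open>rat alg_closure\<close> is the algebraic closure of the rationals.
  A Laurent series in \<open>1/T\<close> is an element of \<open>'a fls\<close> whose formal variable stands for \<open>1/T\<close>:
  the coefficient of \<open>T ^ i\<close> in \<open>\<alpha>\<close> is \<open>fls_nth \<alpha> (- i)\<close>, and \<open>T\<close> itself is \<open>fls_X_inv\<close>.
\<close>

type_synonym qbar = "rat alg_closure"

definition poly_to_laurent :: "'a::field poly \<Rightarrow> 'a fls" where
  "poly_to_laurent P = poly (map_poly fls_const P) fls_X_inv"

text \<open>\<open>fls_prpart\<close> omits the constant term.\<close>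

definition poly_part :: "'a::field fls \<Rightarrow> 'a poly" where
  "poly_part \<alpha> = fls_prpart \<alpha> + [:fls_nth \<alpha> 0:]"

lemma coeff_poly_part: "poly.coeff (poly_part \<alpha>) i = fls_nth \<alpha> (- int i)"
  by (cases i) (simp_all add: poly_part_def)

lemma poly_to_laurent_pCons:
  "poly_to_laurent (pCons c P) = fls_const c + fls_X_inv * poly_to_laurent P"
  by (cases "c = 0 \<and> P = 0") (auto simp: poly_to_laurent_def map_poly_pCons)

lemma poly_to_laurent_nth:
  "fls_nth (poly_to_laurent P) k = (if k \<le> 0 then poly.coeff P (nat (- k)) else 0)"
proof (induction P arbitrary: k)
  case 0
  show ?case by (simp add: poly_to_laurent_def)
next
  case (pCons c P)
  have eq: "nat (- k) = Suc (nat (- (k + 1)))" if "k < 0"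
    using that by simp
  show ?case
    using pCons.IH[of "k + 1"] eq
    by (auto simp: poly_to_laurent_pCons fls_X_inv_times_conv_shift)
qed

definition S_qbar :: "qbar poly set" where
  "S_qbar = {D. Polynomial.degree D > 0 \<and> even (Polynomial.degree D) \<and> (\<nexists>f. D = f ^ 2)}"

text \<open>
  The expansion stops when a complete quotient is a polynomial, where the total functions below
  continue with \<open>inverse 0 = 0\<close>. This never happens for a square root of a \<open>D \<in> S_qbar\<close>, which is
  not a rational function.
\<close>

fun complete_quotient :: "'a::field fls \<Rightarrow> nat \<Rightarrow> 'a fls" where
  "complete_quotient \<alpha> 0 = \<alpha>"
| "complete_quotient \<alpha> (Suc n) =
     inverse (complete_quotient \<alpha> n - poly_to_laurent (poly_part (complete_quotient \<alpha> n)))"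

definition partial_quotient :: "'a::field fls \<Rightarrow> nat \<Rightarrow> 'a poly" where
  "partial_quotient \<alpha> n = poly_part (complete_quotient \<alpha> n)"

text \<open>The index is shifted by 2: the first two values are those with index \<open>-2\<close> and \<open>-1\<close>.\<close>

fun continuant_p :: "'a::field fls \<Rightarrow> nat \<Rightarrow> 'a poly" where
  "continuant_p \<alpha> 0 = 0"
| "continuant_p \<alpha> (Suc 0) = 1"
| "continuant_p \<alpha> (Suc (Suc n)) =
     partial_quotient \<alpha> n * continuant_p \<alpha> (Suc n) + continuant_p \<alpha> n"

fun continuant_q :: "'a::field fls \<Rightarrow> nat \<Rightarrow> 'a poly" where
  "continuant_q \<alpha> 0 = 1"
| "continuant_q \<alpha> (Suc 0) = 0"
| "continuant_q \<alpha> (Suc (Suc n)) =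
     partial_quotient \<alpha> n * continuant_q \<alpha> (Suc n) + continuant_q \<alpha> n"

definition convergent_num :: "'a::field fls \<Rightarrow> nat \<Rightarrow> 'a poly" where
  "convergent_num \<alpha> n = continuant_p \<alpha> (n + 2)"

definition convergent_den :: "'a::field fls \<Rightarrow> nat \<Rightarrow> 'a poly" where
  "convergent_den \<alpha> n = continuant_q \<alpha> (n + 2)"

text \<open>The argument \<open>s\<close> is meant to be a square root of the leading coefficient of \<open>D\<close>.\<close>

definition coeff_field :: "qbar poly \<Rightarrow> qbar \<Rightarrow> qbar set" where
  "coeff_field D s = generate_field ring_of_type_algebra (insert s (range (poly.coeff D)))"

definition laurent_over :: "'a::field set \<Rightarrow> 'a fls set" where
  "laurent_over K = {\<alpha>. \<forall>i. fls_nth \<alpha> i \<in> K}"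

text \<open>
  Discrete valuations of a subfield \<open>K\<close> are normalized and defined on the nonzero elements of \<open>K\<close>.
  Extensionality makes them determined by their values there, so that finiteness of a set of
  valuations has the intended meaning.
\<close>

definition discrete_valuation :: "'a::field set \<Rightarrow> ('a \<Rightarrow> int) \<Rightarrow> bool" where
  "discrete_valuation K \<nu> \<longleftrightarrow>
     \<nu> \<in> extensional (K - {0}) \<and>
     \<nu> ` (K - {0}) = UNIV \<and>
     (\<forall>x\<in>K - {0}. \<forall>y\<in>K - {0}. \<nu> (x * y) = \<nu> x + \<nu> y) \<and>
     (\<forall>x\<in>K - {0}. \<forall>y\<in>K - {0}. x + y \<noteq> 0 \<longrightarrow> \<nu> (x + y) \<ge> min (\<nu> x) (\<nu> y))"

definition uniformizer :: "'a::field set \<Rightarrow> ('a \<Rightarrow> int) \<Rightarrow> 'a \<Rightarrow> bool" where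
  "uniformizer K \<nu> \<pi> \<longleftrightarrow> \<pi> \<in> K - {0} \<and> \<nu> \<pi> = 1"

end

theory Submission
  imports Defs
begin

text \<open>
  Let \<open>\<nu>\<close> be a valuation at which \<open>D\<close> is integral and \<open>2\<close>, the leading coefficient of \<open>D\<close> and some
  nonzero coefficient of \<open>D - \<lfloor>\<alpha>\<rfloor>\<^sup>2\<close> are units; this excludes only finitely many \<open>\<nu>\<close>. Then \<open>\<alpha>\<close> has
  integral coefficients and its reduction is not rational. Scale \<open>q = q\<^sub>n\<close> to be primitive. Since
  \<open>\<alpha> q - p\<close> has order of vanishing at infinity greater than \<open>N = deg q\<close>, while its product with
  \<open>\<alpha> q + p\<close> is a polynomial that is nonzero modulo \<open>\<nu>\<close>, the reduction of \<open>q\<close> has degree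
  \<open>j > N - d\<close>. At \<open>\<lambda>\<close> of valuation \<open>- 1 / r\<close> with \<open>r \<ge> d\<close> the term of degree \<open>j\<close> is therefore
  the unique term of smallest valuation, and \<open>q(\<lambda>) \<noteq> 0\<close>.

  That an element is a unit at almost all \<open>\<nu>\<close> reduces to bounding the number of \<open>\<nu>\<close> above a
  prime: weak approximation yields, for distinct such valuations, as many elements that are
  linearly independent over the rationals.
\<close>

subsection \<open>Laurent series over subrings and subfields\<close>

locale subring_set =
  fixes R :: "'a::field set"
  assumes one_closed: "1 \<in> R"
    and add_closed: "x \<in> R \<Longrightarrow> y \<in> R \<Longrightarrow> x + y \<in> R"
    and uminus_closed: "x \<in> R \<Longrightarrow> - x \<in> R"
    and mult_closed: "x \<in> R \<Longrightarrow> y \<in> R \<Longrightarrow> x * y \<in> R"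
begin

lemma zero_closed: "0 \<in> R"
  using add_closed[OF one_closed uminus_closed[OF one_closed]] by simp

lemma diff_closed: "x \<in> R \<Longrightarrow> y \<in> R \<Longrightarrow> x - y \<in> R"
  using add_closed[of x "- y"] uminus_closed by simp

lemma cancel_closed:
  assumes "x * y \<in> R" "inverse x \<in> R" "x \<noteq> 0"
  shows "y \<in> R"
  using mult_closed[OF assms(2,1)] assms(3) by (simp add: mult.assoc[symmetric])

lemma sum_closed: "(\<And>i. i \<in> A \<Longrightarrow> f i \<in> R) \<Longrightarrow> sum f A \<in> R"
  by (induction A rule: infinite_finite_induct) (auto intro: zero_closed add_closed)

lemma power_closed: "x \<in> R \<Longrightarrow> x ^ n \<in> R"
  by (induction n) (auto intro: one_closed mult_closed)

lemma of_nat_closed: "of_nat n \<in> R"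
  by (induction n) (auto intro: zero_closed one_closed add_closed)

lemma of_int_closed: "of_int n \<in> R"
  by (cases n rule: int_cases2) (auto intro: of_nat_closed uminus_closed)

lemma coeff_mult_closed:
  assumes "\<And>i. poly.coeff p i \<in> R" "\<And>i. poly.coeff q i \<in> R"
  shows "poly.coeff (p * q) i \<in> R"
  unfolding coeff_mult by (intro sum_closed mult_closed assms)

lemma laurent_over_add: "f \<in> laurent_over R \<Longrightarrow> g \<in> laurent_over R \<Longrightarrow> f + g \<in> laurent_over R"
  by (simp add: laurent_over_def add_closed)

lemma laurent_over_diff: "f \<in> laurent_over R \<Longrightarrow> g \<in> laurent_over R \<Longrightarrow> f - g \<in> laurent_over R"
  by (simp add: laurent_over_def diff_closed)

lemma laurent_over_mult: "f \<in> laurent_over R \<Longrightarrow> g \<in> laurent_over R \<Longrightarrow> f * g \<in> laurent_over R"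
  by (auto simp: laurent_over_def fls_times_nth(2) intro!: sum_closed mult_closed)

lemma laurent_over_poly:
  "poly_to_laurent P \<in> laurent_over R \<longleftrightarrow> (\<forall>i. poly.coeff P i \<in> R)"
proof
  assume *: "poly_to_laurent P \<in> laurent_over R"
  show "\<forall>i. poly.coeff P i \<in> R"
  proof
    fix i
    show "poly.coeff P i \<in> R"
      using * unfolding laurent_over_def mem_Collect_eq
      by (auto simp: poly_to_laurent_nth dest!: spec[of _ "- int i"])
  qed
qed (auto simp: laurent_over_def poly_to_laurent_nth zero_closed)

lemma laurent_over_poly_part: "f \<in> laurent_over R \<Longrightarrow> poly.coeff (poly_part f) i \<in> R"
  by (simp add: laurent_over_def coeff_poly_part)

text \<open>Each coefficient of \<open>f ^ 2\<close> is twice the leading coefficient of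
  \<open>f\<close> times a new coefficient, plus products of earlier ones. The recursion divides
  only by twice the leading coefficient and so stays inside a ring such as a valuation ring.\<close>

lemma laurent_over_sqrt:
  assumes f2: "f ^ 2 \<in> laurent_over R"
    and lead: "fls_nth f (fls_subdegree f) \<in> R" "inverse (2 * fls_nth f (fls_subdegree f)) \<in> R"
    and two: "(2 :: 'a) \<noteq> 0"
  shows "f \<in> laurent_over R"
proof (cases "f = 0")
  case True
  then show ?thesis by (simp add: laurent_over_def zero_closed)
next
  case False
  define a where "a = fls_subdegree f"
  have a0: "fls_nth f a \<noteq> 0" using False by (simp add: a_def)
  have "fls_nth f (a + int n) \<in> R" for n
  proof (induction n rule: less_induct)
    case (less n)
    show ?case
    proof (cases "n = 0")
      case True
      then show ?thesis using lead by (simp add: a_def)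
    next
      case n: False
      have "{a..a + int n} = insert a (insert (a + int n) {a<..<a + int n})"
        using n by auto
      hence "fls_nth (f ^ 2) (2 * a + int n) =
          2 * fls_nth f a * fls_nth f (a + int n) +
            (\<Sum>i\<in>{a<..<a + int n}. fls_nth f i * fls_nth f (2 * a + int n - i))"
        using n by (simp add: power2_eq_square fls_times_nth(2) a_def[symmetric] algebra_simps)
      moreover have "(\<Sum>i\<in>{a<..<a + int n}. fls_nth f i * fls_nth f (2 * a + int n - i)) \<in> R"
      proof (intro sum_closed mult_closed)
        fix i assume i: "i \<in> {a<..<a + int n}"
        show "fls_nth f i \<in> R"
          using less[of "nat (i - a)"] i by (simp add: nat_less_iff)
        show "fls_nth f (2 * a + int n - i) \<in> R"
          using less[of "nat (a + int n - i)"] i by (simp add: nat_less_iff algebra_simps)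
      qed
      moreover have "fls_nth (f ^ 2) (2 * a + int n) \<in> R"
        using f2 by (simp add: laurent_over_def)
      ultimately have "2 * fls_nth f a * fls_nth f (a + int n) \<in> R"
        by (metis add_diff_cancel_right' diff_closed)
      thus ?thesis
        by (rule cancel_closed) (use lead(2) a0 two in \<open>simp_all add: a_def\<close>)
    qed
  qed
  hence "fls_nth f (a + int (nat (i - a))) \<in> R" for i by blast
  hence "fls_nth f i \<in> R" if "i \<ge> a" for i
    using that by (metis add.commute diff_add_cancel diff_ge_0_iff_ge int_nat_eq)
  moreover have "fls_nth f i \<in> R" if "i < a" for i
    using that by (simp add: a_def zero_closed)
  ultimately show ?thesis by (auto simp: laurent_over_def not_le[symmetric])
qed

end

locale subfield_set = subring_set K for K :: "'a::field set" +
  assumes inverse_closed: "x \<in> K \<Longrightarrow> inverse x \<in> K"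
begin

lemma divide_closed: "x \<in> K \<Longrightarrow> y \<in> K \<Longrightarrow> x / y \<in> K"
  by (simp add: divide_inverse mult_closed inverse_closed)

text \<open>The coefficients of the inverse follow recursively from \<open>f * g = 1\<close>,
  dividing by the leading coefficient of \<open>f\<close> only.\<close>

lemma laurent_over_inverse:
  assumes "f \<in> laurent_over K"
  shows "inverse f \<in> laurent_over K"
proof (cases "f = 0")
  case True
  then show ?thesis by (simp add: laurent_over_def zero_closed)
next
  case False
  define g where "g = inverse f"
  define a where "a = fls_subdegree f"
  have fg: "f * g = 1" using False by (simp add: g_def)
  have a0: "fls_nth f a \<noteq> 0" using False by (simp add: a_def)
  have fK: "fls_nth f i \<in> K" for i using assms by (simp add: laurent_over_def)
  have b: "fls_subdegree g = - a"
    using False by (metis a_def fg fls_one_subdegree fls_subdegree_mult add_eq_0_iff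
        mult_zero_right zero_neq_one)
  have "fls_nth g (- a + int n) \<in> K" for n
  proof (induction n rule: less_induct)
    case (less n)
    have "{a..a + int n} = insert a {a<..a + int n}" by auto
    hence "fls_nth (f * g) (int n) = fls_nth f a * fls_nth g (- a + int n) +
        (\<Sum>i\<in>{a<..a + int n}. fls_nth f i * fls_nth g (int n - i))"
      by (simp add: fls_times_nth(2) b a_def[symmetric] algebra_simps)
    moreover have "(\<Sum>i\<in>{a<..a + int n}. fls_nth f i * fls_nth g (int n - i)) \<in> K"
    proof (intro sum_closed mult_closed fK)
      fix i assume i: "i \<in> {a<..a + int n}"
      show "fls_nth g (int n - i) \<in> K"
        using less[of "nat (a + int n - i)"] i by (simp add: nat_less_iff algebra_simps)
    qed
    moreover have "fls_nth (f * g) (int n) \<in> K"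
      by (simp add: fg one_closed zero_closed)
    ultimately have "fls_nth f a * fls_nth g (- a + int n) \<in> K"
      by (metis add_diff_cancel_right' diff_closed)
    thus ?case
      by (rule cancel_closed) (use a0 fK inverse_closed in auto)
  qed
  hence "fls_nth g (- a + int (nat (i - (- a)))) \<in> K" for i by blast
  hence "fls_nth g i \<in> K" if "i \<ge> - a" for i
    using that by (metis add.commute diff_add_cancel diff_ge_0_iff_ge int_nat_eq)
  moreover have "fls_nth g i \<in> K" if "i < - a" for i
    using that b by (simp add: zero_closed)
  ultimately show ?thesis by (auto simp: laurent_over_def not_le[symmetric] g_def)
qed

lemma laurent_over_complete_quotient:
  assumes "\<alpha> \<in> laurent_over K"
  shows "complete_quotient \<alpha> n \<in> laurent_over K"
  by (induction n)
    (auto intro!: assms laurent_over_inverse laurent_over_diff laurent_over_poly_part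
      simp: laurent_over_poly)

lemma coeff_continuant_q_closed:
  assumes "\<alpha> \<in> laurent_over K"
  shows "poly.coeff (continuant_q \<alpha> n) i \<in> K"
  using assms
proof (induction \<alpha> n arbitrary: i rule: continuant_q.induct)
  case (3 \<alpha> n)
  then show ?case
    by (auto simp: partial_quotient_def intro!: add_closed coeff_mult_closed
        laurent_over_poly_part laurent_over_complete_quotient)
qed (auto simp: coeff_1 zero_closed one_closed)

end

subsection \<open>Convergents of Laurent series\<close>

lemma poly_to_laurent_eq_iff [simp]: "poly_to_laurent P = poly_to_laurent Q \<longleftrightarrow> P = Q"
proof
  assume eq: "poly_to_laurent P = poly_to_laurent Q"
  show "P = Q"
  proof (rule poly_eqI)
    fix n
    show "poly.coeff P n = poly.coeff Q n"
      using arg_cong[OF eq, of "\<lambda>f. fls_nth f (- int n)"] by (simp add: poly_to_laurent_nth)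
  qed
qed simp

lemma poly_to_laurent_0 [simp]: "poly_to_laurent 0 = 0"
  by (simp add: poly_to_laurent_def)

lemma poly_to_laurent_1 [simp]: "poly_to_laurent 1 = 1"
  by (rule fls_eqI) (auto simp: poly_to_laurent_nth coeff_1)

lemma poly_to_laurent_add: "poly_to_laurent (P + Q) = poly_to_laurent P + poly_to_laurent Q"
  by (rule fls_eqI) (simp add: poly_to_laurent_nth)

lemma poly_to_laurent_diff: "poly_to_laurent (P - Q) = poly_to_laurent P - poly_to_laurent Q"
  by (rule fls_eqI) (simp add: poly_to_laurent_nth)

lemma poly_to_laurent_minus: "poly_to_laurent (- P) = - poly_to_laurent P"
  by (rule fls_eqI) (simp add: poly_to_laurent_nth)

lemma poly_to_laurent_smult: "poly_to_laurent (smult c P) = fls_const c * poly_to_laurent P"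
  by (rule fls_eqI) (simp add: poly_to_laurent_nth)

lemma poly_to_laurent_mult: "poly_to_laurent (P * Q) = poly_to_laurent P * poly_to_laurent Q"
proof (induction P)
  case (pCons c P)
  then show ?case
    by (simp add: poly_to_laurent_pCons poly_to_laurent_add poly_to_laurent_smult algebra_simps)
qed simp

lemma poly_to_laurent_power: "poly_to_laurent (P ^ n) = poly_to_laurent P ^ n"
  by (induction n) (simp_all add: poly_to_laurent_mult)

lemma subdegree_poly_to_laurent:
  assumes "P \<noteq> 0"
  shows "fls_subdegree (poly_to_laurent P) = - int (Polynomial.degree P)"
  using assms
  by (intro fls_subdegree_eqI) (auto simp: poly_to_laurent_nth coeff_eq_0)

lemma degree_poly_part:
  assumes "fls_subdegree \<theta> < 0"
  shows "int (Polynomial.degree (poly_part \<theta>)) = - fls_subdegree \<theta>"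
proof -
  have "Polynomial.degree (poly_part \<theta>) = nat (- fls_subdegree \<theta>)"
  proof (rule antisym)
    show "Polynomial.degree (poly_part \<theta>) \<le> nat (- fls_subdegree \<theta>)"
      by (rule degree_le) (use assms in \<open>auto simp: coeff_poly_part\<close>)
    have "fls_nth \<theta> (fls_subdegree \<theta>) \<noteq> 0"
      using assms by (intro nth_fls_subdegree_nonzero) auto
    thus "nat (- fls_subdegree \<theta>) \<le> Polynomial.degree (poly_part \<theta>)"
      using assms by (intro le_degree) (simp add: coeff_poly_part)
  qed
  thus ?thesis using assms by simp
qed

text \<open>The error at a convergent has order equal to the degree of the next denominator, and
  these degrees strictly increase. The hypothesis \<open>irrational\<close> keeps every fractional
  part nonzero, so the expansion never inverts 0.\<close>

lemma convergent_error:
  fixes \<alpha> :: "'a::field fls" and n :: nat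
  defines "e \<equiv> \<lambda>n. \<alpha> * poly_to_laurent (continuant_q \<alpha> n) - poly_to_laurent (continuant_p \<alpha> n)"
  assumes neg: "fls_subdegree \<alpha> < 0"
    and irrational: "\<And>n. continuant_q \<alpha> n \<noteq> 0 \<Longrightarrow> e n \<noteq> 0"
  shows "continuant_q \<alpha> (n + 2) \<noteq> 0"
    and "fls_subdegree (e (n + 2)) > int (Polynomial.degree (continuant_q \<alpha> (n + 2)))"
proof -
  let ?q = "continuant_q \<alpha>" and ?\<theta> = "complete_quotient \<alpha>" and ?a = "partial_quotient \<alpha>"
  have rec: "e (Suc (Suc n)) = poly_to_laurent (?a n) * e (Suc n) + e n" for n
    by (simp add: e_def poly_to_laurent_add poly_to_laurent_mult algebra_simps)
  \<comment> \<open>The complete quotients satisfy \<open>\<theta>\<^sub>n = - e\<^sub>n / e\<^sub>n\<^sub>+\<^sub>1\<close>, so the orders of the \<open>e\<^sub>n\<close> add up the degrees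
    of the partial quotients.\<close>
  have inv: "?q (n + 2) \<noteq> 0 \<and> e (n + 1) \<noteq> 0 \<and>
      fls_subdegree (e (n + 1)) = int (Polynomial.degree (?q (n + 2))) \<and>
      fls_subdegree (?\<theta> n) < 0 \<and> e (n + 1) * ?\<theta> n = - e n \<and>
      (?q (n + 1) = 0 \<or> Polynomial.degree (?q (n + 1)) < Polynomial.degree (?q (n + 2)))" for n
  proof (induction n)
    case 0
    show ?case using neg by (simp add: e_def numeral_2_eq_2)
  next
    case (Suc n)
    define \<delta> where "\<delta> = ?\<theta> n - poly_to_laurent (?a n)"
    have IH: "?q (n + 2) \<noteq> 0" "e (n + 1) \<noteq> 0"
        "fls_subdegree (e (n + 1)) = int (Polynomial.degree (?q (n + 2)))"
        "e (n + 1) * ?\<theta> n = - e n"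
        "?q (n + 1) = 0 \<or> Polynomial.degree (?q (n + 1)) < Polynomial.degree (?q (n + 2))"
      using Suc.IH by blast+
    have e2: "e (n + 2) = - (e (n + 1) * \<delta>)"
      using rec[of n] IH(4) by (simp add: \<delta>_def algebra_simps)
    have e2_nz: "e (n + 2) \<noteq> 0" by (rule irrational[OF IH(1)])
    have \<delta>_nz: "\<delta> \<noteq> 0" using e2 e2_nz by auto
    have \<delta>_pos: "fls_subdegree \<delta> > 0"
      by (rule fls_subdegree_greaterI[OF \<delta>_nz])
        (auto simp: \<delta>_def poly_to_laurent_nth partial_quotient_def coeff_poly_part)
    have \<theta>: "?\<theta> (Suc n) = inverse \<delta>"
      by (simp add: \<delta>_def partial_quotient_def)
    have eq: "e (n + 2) * ?\<theta> (Suc n) = - e (n + 1)"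
      using \<delta>_nz unfolding e2 \<theta> by simp
    hence eq': "e (n + 2) * ?\<theta> (Suc n) = - e (Suc n)" by simp
    have \<theta>_nz: "?\<theta> (Suc n) \<noteq> 0" using \<delta>_nz \<theta> by simp
    have "fls_subdegree (\<delta> * ?\<theta> (Suc n)) = 0" unfolding \<theta> using \<delta>_nz by (simp del: fls_subdegree_mult)
    hence \<theta>_deg: "fls_subdegree (?\<theta> (Suc n)) < 0"
      using \<delta>_nz \<theta>_nz \<delta>_pos by simp
    have "fls_subdegree (e (n + 2) * ?\<theta> (Suc n)) = int (Polynomial.degree (?q (n + 2)))"
      unfolding eq using IH(3) by simp
    hence e_deg: "fls_subdegree (e (n + 2)) + fls_subdegree (?\<theta> (Suc n)) =
        int (Polynomial.degree (?q (n + 2)))"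
      using e2_nz \<theta>_nz by simp
    have a_deg: "int (Polynomial.degree (?a (Suc n))) = - fls_subdegree (?\<theta> (Suc n))"
      unfolding partial_quotient_def by (rule degree_poly_part[OF \<theta>_deg])
    hence a_nz: "?a (Suc n) \<noteq> 0" using \<theta>_deg by auto
    have prod_deg: "Polynomial.degree (?a (Suc n) * ?q (n + 2)) =
        Polynomial.degree (?a (Suc n)) + Polynomial.degree (?q (n + 2))"
      using a_nz IH(1) by (simp add: degree_mult_eq)
    have q3: "?q (n + 3) = ?a (Suc n) * ?q (n + 2) + ?q (n + 1)"
      by (simp add: numeral_3_eq_3 numeral_2_eq_2)
    \<comment> \<open>The zero polynomial \<open>continuant_q \<alpha> 1\<close> also has degree 0,
      which would break strict growth at the start; hence the separate case.\<close>
    have q3_deg: "Polynomial.degree (?q (n + 3)) =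
        Polynomial.degree (?a (Suc n)) + Polynomial.degree (?q (n + 2))"
      using IH(5)
    proof
      assume "?q (n + 1) = 0"
      thus ?thesis using q3 prod_deg by simp
    next
      assume "Polynomial.degree (?q (n + 1)) < Polynomial.degree (?q (n + 2))"
      thus ?thesis using q3 prod_deg by (simp add: degree_add_eq_left)
    qed
    hence less: "Polynomial.degree (?q (n + 2)) < Polynomial.degree (?q (n + 3))"
      using a_deg \<theta>_deg by simp
    have q3_nz: "?q (n + 3) \<noteq> 0" using less by auto
    have e3: "fls_subdegree (e (n + 2)) = int (Polynomial.degree (?q (n + 3)))"
      using e_deg a_deg q3_deg by simp
    have idx: "Suc n + 2 = n + 3" "Suc n + 1 = n + 2" by simp_all
    show ?case unfolding idx
      using q3_nz e2_nz e3 \<theta>_deg eq' less by blast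
  qed
  show "?q (n + 2) \<noteq> 0" using inv[of n] by blast
  have idx: "Suc n + 2 = n + 3" "Suc n + 1 = n + 2" by simp_all
  show "fls_subdegree (e (n + 2)) > int (Polynomial.degree (?q (n + 2)))"
    using inv[of n] inv[of "Suc n"] unfolding idx by auto
qed

subsection \<open>Valuation rings and reduction of Laurent series\<close>

locale discretely_valued_field = subfield_set K for K :: "'a::field set" +
  fixes \<nu> :: "'a \<Rightarrow> int"
  assumes valuation: "discrete_valuation K \<nu>"
begin

lemma val_mult: "x \<in> K \<Longrightarrow> y \<in> K \<Longrightarrow> x \<noteq> 0 \<Longrightarrow> y \<noteq> 0 \<Longrightarrow> \<nu> (x * y) = \<nu> x + \<nu> y"
  using valuation by (auto simp: discrete_valuation_def)

lemma val_add:
  "x \<in> K \<Longrightarrow> y \<in> K \<Longrightarrow> x \<noteq> 0 \<Longrightarrow> y \<noteq> 0 \<Longrightarrow> x + y \<noteq> 0 \<Longrightarrow> min (\<nu> x) (\<nu> y) \<le> \<nu> (x + y)"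
  using valuation by (auto simp: discrete_valuation_def)

lemma val_surj: "\<exists>x\<in>K. x \<noteq> 0 \<and> \<nu> x = n"
proof -
  have "n \<in> \<nu> ` (K - {0})" using valuation by (simp add: discrete_valuation_def)
  thus ?thesis by auto
qed

lemma val_one [simp]: "\<nu> 1 = 0"
  using val_mult[of 1 1] one_closed by simp

lemma val_inverse: "x \<in> K \<Longrightarrow> x \<noteq> 0 \<Longrightarrow> \<nu> (inverse x) = - \<nu> x"
  using val_mult[of x "inverse x"] by (simp add: inverse_closed)

lemma val_minus: "x \<in> K \<Longrightarrow> \<nu> (- x) = \<nu> x"
proof (cases "x = 0")
  case False
  assume x: "x \<in> K"
  have "\<nu> (- 1) = 0"
    using val_mult[of "- 1" "- 1"] one_closed uminus_closed by simp
  thus ?thesis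
    using val_mult[of "- 1" x] x False one_closed uminus_closed by simp
qed simp

lemma val_power: "x \<in> K \<Longrightarrow> x \<noteq> 0 \<Longrightarrow> \<nu> (x ^ n) = int n * \<nu> x"
  by (induction n) (simp_all add: val_mult power_closed algebra_simps)

text \<open>Equality comes from a second use of the ultrametric inequality, for \<open>x\<close> as
  the sum of \<open>x + y\<close> and \<open>- y\<close>.\<close>

lemma val_add_less:
  assumes "x \<in> K" "y \<in> K" "x \<noteq> 0" "y \<noteq> 0" "\<nu> x < \<nu> y"
  shows "x + y \<noteq> 0 \<and> \<nu> (x + y) = \<nu> x"
proof -
  have nz: "x + y \<noteq> 0"
    using assms val_minus[of y] by (auto simp: add_eq_0_iff2)
  moreover have "\<nu> (x + y) \<ge> \<nu> x"
    using val_add[of x y] assms nz by simp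
  moreover have "\<nu> x \<ge> min (\<nu> (x + y)) (\<nu> y)"
    using val_add[of "x + y" "- y"] assms nz by (simp add: add_closed uminus_closed val_minus)
  ultimately show ?thesis using assms(5) by simp
qed

definition vring :: "'a set" where
  "vring = {x \<in> K. x \<noteq> 0 \<longrightarrow> \<nu> x \<ge> 0}"

definition vmax :: "'a set" where
  "vmax = {x \<in> K. x \<noteq> 0 \<longrightarrow> \<nu> x > 0}"

lemma vmax_imp_vring: "x \<in> vmax \<Longrightarrow> x \<in> vring"
  by (auto simp: vring_def vmax_def)

lemma zero_vmax [simp]: "0 \<in> vmax"
  by (simp add: vmax_def zero_closed)

lemma one_not_vmax [simp]: "1 \<notin> vmax"
  by (simp add: vmax_def)

lemma vmax_add: "x \<in> vmax \<Longrightarrow> y \<in> vmax \<Longrightarrow> x + y \<in> vmax"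
  using val_add[of x y] by (cases "x = 0"; cases "y = 0") (auto simp: vmax_def add_closed)

lemma vmax_uminus: "x \<in> vmax \<Longrightarrow> - x \<in> vmax"
  by (auto simp: vmax_def val_minus uminus_closed)

lemma vmax_diff: "x \<in> vmax \<Longrightarrow> y \<in> vmax \<Longrightarrow> x - y \<in> vmax"
  using vmax_add[of x "- y"] vmax_uminus by simp

lemma vmax_sum: "(\<And>i. i \<in> A \<Longrightarrow> f i \<in> vmax) \<Longrightarrow> sum f A \<in> vmax"
  by (induction A rule: infinite_finite_induct) (auto intro: vmax_add)

lemma vmax_mult_left: "x \<in> vring \<Longrightarrow> y \<in> vmax \<Longrightarrow> x * y \<in> vmax"
  by (auto simp: vmax_def vring_def val_mult mult_closed)

lemma vmax_mult_right: "x \<in> vmax \<Longrightarrow> y \<in> vring \<Longrightarrow> x * y \<in> vmax"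
  using vmax_mult_left[of y x] by (simp add: mult.commute)

lemma vmax_prime: "x \<in> vring \<Longrightarrow> y \<in> vring \<Longrightarrow> x * y \<in> vmax \<Longrightarrow> x \<in> vmax \<or> y \<in> vmax"
  by (force simp: vmax_def vring_def val_mult)

lemma unit_iff: "x \<in> vring \<and> x \<notin> vmax \<longleftrightarrow> x \<in> K \<and> x \<noteq> 0 \<and> \<nu> x = 0"
  by (auto simp: vmax_def vring_def)

lemma vring_divide_unit: "x \<in> vring \<Longrightarrow> y \<in> vring \<Longrightarrow> y \<notin> vmax \<Longrightarrow> x / y \<in> vring"
  using unit_iff[of y]
  by (auto simp: vring_def divide_inverse val_mult val_inverse mult_closed inverse_closed)

lemma vmax_divide_unit: "x \<in> vmax \<Longrightarrow> y \<in> vring \<Longrightarrow> y \<notin> vmax \<Longrightarrow> x / y \<in> vmax"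
  using unit_iff[of y]
  by (auto simp: vmax_def divide_inverse val_mult val_inverse mult_closed inverse_closed)

lemma vmax_diff_cancel: "x \<in> vmax \<Longrightarrow> y \<notin> vmax \<Longrightarrow> y - x \<notin> vmax"
  using vmax_add[of x "y - x"] by auto

sublocale vring: subring_set vring
proof
  fix x y assume xy: "x \<in> vring" "y \<in> vring"
  show "x + y \<in> vring"
    using xy val_add[of x y] by (cases "x = 0"; cases "y = 0") (auto simp: vring_def add_closed)
  show "x * y \<in> vring"
    using xy by (auto simp: vring_def val_mult mult_closed)
next
  fix x assume "x \<in> vring"
  thus "- x \<in> vring" by (auto simp: vring_def val_minus uminus_closed)
qed (simp add: vring_def one_closed)

text \<open>The order in \<open>1/T\<close> of the reduction of \<open>f\<close> modulo the maximal ideal.\<close>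

definition reduced_order :: "'a fls \<Rightarrow> int \<Rightarrow> bool" where
  "reduced_order f k \<longleftrightarrow> fls_nth f k \<notin> vmax \<and> (\<forall>i<k. fls_nth f i \<in> vmax)"

text \<open>All coefficients below the subdegree vanish, so the search for the first one outside
  \<open>vmax\<close> can start there.\<close>

lemma ex_reduced_order:
  assumes "f \<notin> laurent_over vmax"
  obtains k where "reduced_order f k"
proof -
  from assms obtain i where i: "fls_nth f i \<notin> vmax" by (auto simp: laurent_over_def)
  hence "fls_nth f i \<noteq> 0" by auto
  hence ge: "fls_subdegree f \<le> i" by (rule fls_subdegree_leI)
  define n where "n = (LEAST n. fls_nth f (fls_subdegree f + int n) \<notin> vmax)"
  have ex: "fls_nth f (fls_subdegree f + int (nat (i - fls_subdegree f))) \<notin> vmax"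
    using i ge by simp
  have "fls_nth f (fls_subdegree f + int n) \<notin> vmax"
    unfolding n_def using ex by (rule LeastI)
  moreover have "fls_nth f j \<in> vmax" if "j < fls_subdegree f + int n" for j
  proof (cases "j < fls_subdegree f")
    case False
    have "nat (j - fls_subdegree f) < n" using that False by auto
    from not_less_Least[OF this[unfolded n_def]] False show ?thesis by simp
  qed simp
  ultimately show ?thesis by (intro that) (auto simp: reduced_order_def)
qed

lemma reduced_order_ge: "reduced_order f k \<Longrightarrow> (\<And>i. i < m \<Longrightarrow> fls_nth f i \<in> vmax) \<Longrightarrow> m \<le> k"
  by (meson reduced_order_def not_le)

lemma reduced_order_cong:
  assumes "reduced_order f k" "f - g \<in> laurent_over vmax"
  shows "reduced_order g k"
proof -
  have *: "fls_nth f i - fls_nth g i \<in> vmax" for i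
    using assms(2) by (simp add: laurent_over_def)
  have "fls_nth g i \<in> vmax \<longleftrightarrow> fls_nth f i \<in> vmax" for i
    using vmax_add[OF *[of i], of "fls_nth g i"] vmax_diff[OF _ *[of i], of "fls_nth f i"] by auto
  thus ?thesis using assms(1) by (simp add: reduced_order_def)
qed

lemma laurent_over_vmax_mult:
  assumes "f \<in> laurent_over vring" "g \<in> laurent_over vmax"
  shows "f * g \<in> laurent_over vmax"
  using assms by (auto simp: laurent_over_def fls_times_nth(2) intro!: vmax_sum vmax_mult_left)

lemma laurent_over_vmax_uminus: "f \<in> laurent_over vmax \<Longrightarrow> - f \<in> laurent_over vmax"
  by (simp add: laurent_over_def vmax_uminus)

text \<open>This is Gauss's lemma for Laurent series: at \<open>a + b\<close> only the product of
  the two first surviving coefficients escapes \<open>vmax\<close>, because \<open>vmax\<close> is a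
  prime ideal of \<open>vring\<close>.\<close>

lemma reduced_order_mult:
  assumes f: "f \<in> laurent_over vring" and g: "g \<in> laurent_over vring"
    and a: "reduced_order f a" and b: "reduced_order g b"
  shows "reduced_order (f * g) (a + b)"
proof -
  have fR: "fls_nth f i \<in> vring" and gR: "fls_nth g i \<in> vring" for i
    using f g by (simp_all add: laurent_over_def)
  have small: "fls_nth f i * fls_nth g j \<in> vmax" if "i < a \<or> j < b" for i j
    using that a b fR gR by (auto simp: reduced_order_def intro: vmax_mult_left vmax_mult_right)
  let ?I = "{fls_subdegree f..a + b - fls_subdegree g}"
  have "fls_nth f a \<noteq> 0" "fls_nth g b \<noteq> 0"
    using a b by (auto simp: reduced_order_def)
  hence "a \<in> ?I" using fls_subdegree_leI[of f a] fls_subdegree_leI[of g b] by auto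
  hence "fls_nth (f * g) (a + b) = fls_nth f a * fls_nth g b +
      (\<Sum>i\<in>?I - {a}. fls_nth f i * fls_nth g (a + b - i))"
    by (simp add: fls_times_nth(2) sum.remove[of ?I a])
  moreover have "(\<Sum>i\<in>?I - {a}. fls_nth f i * fls_nth g (a + b - i)) \<in> vmax"
    by (intro vmax_sum small) auto
  moreover have "fls_nth f a * fls_nth g b \<notin> vmax"
    using vmax_prime[OF fR gR] a b by (auto simp: reduced_order_def)
  ultimately have "fls_nth (f * g) (a + b) \<notin> vmax"
    by (metis add_diff_cancel_right' vmax_diff)
  moreover have "fls_nth (f * g) n \<in> vmax" if "n < a + b" for n
    unfolding fls_times_nth(2) using that by (intro vmax_sum small) auto
  ultimately show ?thesis by (simp add: reduced_order_def)
qed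

end

section \<open>Reduced degrees of denominators and their roots\<close>

context discretely_valued_field
begin

text \<open>
  Infinite descent on the reduced degree of \<open>q\<close>: if \<open>\<alpha> q \<equiv> p\<close>, then \<open>q' = p - \<lfloor>\<alpha>\<rfloor> q \<equiv> (\<alpha> - \<lfloor>\<alpha>\<rfloor>) q\<close>
  has smaller reduced degree and \<open>\<alpha> q'\<close> is again congruent to a polynomial.
\<close>
lemma reduction_irrational:
  assumes \<alpha>: "\<alpha> \<in> laurent_over vring" "\<alpha> ^ 2 = poly_to_laurent D"
    and frac: "\<alpha> - poly_to_laurent (poly_part \<alpha>) \<notin> laurent_over vmax"
    and q: "poly_to_laurent q \<in> laurent_over vring" "poly_to_laurent q \<notin> laurent_over vmax"
    and p: "poly_to_laurent p \<in> laurent_over vring"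
  shows "\<alpha> * poly_to_laurent q - poly_to_laurent p \<notin> laurent_over vmax"
proof -
  define A where "A = poly_to_laurent (poly_part \<alpha>)"
  define \<beta> where "\<beta> = \<alpha> - A"
  have A: "A \<in> laurent_over vring"
    using vring.laurent_over_poly_part[OF \<alpha>(1)] by (simp add: A_def vring.laurent_over_poly)
  have \<beta>: "\<beta> \<in> laurent_over vring"
    unfolding \<beta>_def by (intro vring.laurent_over_diff \<alpha> A)
  obtain b where b: "reduced_order \<beta> b"
    using frac ex_reduced_order unfolding \<beta>_def A_def by blast
  have b_pos: "1 \<le> b"
    by (rule reduced_order_ge[OF b])
      (simp add: \<beta>_def A_def poly_to_laurent_nth coeff_poly_part)
  obtain k where k: "reduced_order (poly_to_laurent q) k"
    using q(2) ex_reduced_order by blast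
  from k q(1) p show ?thesis
  proof (induction "nat (- k)" arbitrary: k q p rule: less_induct)
    case less
    let ?q = "poly_to_laurent q" and ?p = "poly_to_laurent p"
    show ?case
    proof
      assume small: "\<alpha> * ?q - ?p \<in> laurent_over vmax"
      define q' where "q' = p - poly_part \<alpha> * q"
      \<comment> \<open>Chosen so that the new error is the old one times
        \<open>- (\<alpha> + A)\<close>; the equation
        \<open>\<alpha> ^ 2 = poly_to_laurent D\<close> is what makes \<open>p'\<close> a
        polynomial.\<close>
      define p' where "p' = D * q - poly_part \<alpha> * p"
      have q'_eq: "poly_to_laurent q' = ?p - A * ?q"
        by (simp add: q'_def A_def poly_to_laurent_diff poly_to_laurent_mult)
      have p'_eq: "poly_to_laurent p' = \<alpha> * \<alpha> * ?q - A * ?p"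
        using \<alpha>(2)
        by (simp add: p'_def A_def poly_to_laurent_diff poly_to_laurent_mult power2_eq_square)
      have "reduced_order (\<beta> * ?q) (b + k)"
        by (rule reduced_order_mult[OF \<beta> less.prems(2) b less.prems(1)])
      moreover have "\<beta> * ?q - poly_to_laurent q' = \<alpha> * ?q - ?p"
        by (simp add: q'_eq \<beta>_def algebra_simps)
      ultimately have k': "reduced_order (poly_to_laurent q') (b + k)"
        using small reduced_order_cong by metis
      have "fls_nth (poly_to_laurent q') (b + k) \<noteq> 0"
        using k' by (auto simp: reduced_order_def)
      \<comment> \<open>A polynomial has no terms of positive order in 1/T. As \<open>b\<close> is
        at least 1, \<open>k\<close> is negative and the descent measure drops.\<close>
      hence "b + k \<le> 0" by (auto simp: poly_to_laurent_nth split: if_splits)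
      hence dec: "nat (- (b + k)) < nat (- k)" using b_pos by simp
      have "\<alpha> * poly_to_laurent q' - poly_to_laurent p' = - ((\<alpha> + A) * (\<alpha> * ?q - ?p))"
        by (simp add: q'_eq p'_eq algebra_simps)
      also have "\<dots> \<in> laurent_over vmax"
        by (intro laurent_over_vmax_uminus laurent_over_vmax_mult vring.laurent_over_add \<alpha> A small)
      finally have "\<alpha> * poly_to_laurent q' - poly_to_laurent p' \<in> laurent_over vmax" .
      moreover have "poly_to_laurent q' \<in> laurent_over vring"
        "poly_to_laurent p' \<in> laurent_over vring"
        unfolding q'_eq p'_eq
        by (intro vring.laurent_over_diff vring.laurent_over_mult \<alpha> A less.prems)+
      ultimately show False
        using less.hyps[OF dec k'] by blast
    qed
  qed
qed

lemma reduced_degree_bound: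
  assumes \<alpha>: "\<alpha> \<in> laurent_over vring" "\<alpha> ^ 2 = poly_to_laurent D" "reduced_order \<alpha> (- int d)"
    and frac: "\<alpha> - poly_to_laurent (poly_part \<alpha>) \<notin> laurent_over vmax"
    and q: "\<And>i. poly.coeff q i \<in> vring" "\<exists>i. poly.coeff q i \<notin> vmax"
    and approx: "\<And>k. k \<le> int N \<Longrightarrow> fls_nth (\<alpha> * poly_to_laurent q - poly_to_laurent p) k = 0"
  obtains j where "poly.coeff q j \<notin> vmax" "\<And>i. j < i \<Longrightarrow> poly.coeff q i \<in> vmax"
    and "N + 1 \<le> j + d"
proof -
  let ?q = "poly_to_laurent q" and ?p = "poly_to_laurent p"
  have qR: "?q \<in> laurent_over vring" using q(1) by (simp add: vring.laurent_over_poly)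
  have q_red: "?q \<notin> laurent_over vmax"
  proof
    assume *: "?q \<in> laurent_over vmax"
    obtain i where "poly.coeff q i \<notin> vmax" using q(2) by blast
    moreover have "fls_nth ?q (- int i) \<in> vmax" using * by (simp add: laurent_over_def)
    ultimately show False by (simp add: poly_to_laurent_nth)
  qed
  have \<alpha>q: "\<alpha> * ?q \<in> laurent_over vring" by (rule vring.laurent_over_mult[OF \<alpha>(1) qR])
  have p_eq: "fls_nth ?p i = fls_nth (\<alpha> * ?q) i" if "i \<le> 0" for i
    using approx[of i] that by simp
  have pR: "?p \<in> laurent_over vring"
    using \<alpha>q p_eq by (auto simp: laurent_over_def poly_to_laurent_nth vring.zero_closed)
  obtain k where k: "reduced_order ?q k" using q_red ex_reduced_order by blast
  have k_coeff: "fls_nth ?q k \<notin> vmax" using k by (simp add: reduced_order_def)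
  have k_le: "k \<le> 0"
  proof (rule ccontr)
    assume "\<not> k \<le> 0"
    thus False using k_coeff by (simp add: poly_to_laurent_nth)
  qed
  have e: "\<alpha> * ?q - ?p \<notin> laurent_over vmax"
    by (rule reduction_irrational[OF \<alpha>(1,2) frac qR q_red pR])
  then obtain a where a: "reduced_order (\<alpha> * ?q - ?p) a" using ex_reduced_order by blast
  have a_ge: "int N + 1 \<le> a"
    by (rule reduced_order_ge[OF a]) (use approx in \<open>simp del: fls_minus_nth\<close>)
  \<comment> \<open>The pair \<open>q\<close>, \<open>- p\<close> satisfies the same hypotheses, so
    the conjugate factor does not vanish in the reduction either.\<close>
  have npR: "poly_to_laurent (- p) \<in> laurent_over vring"
    using pR by (simp add: vring.laurent_over_poly vring.uminus_closed)
  have "\<alpha> * ?q + ?p \<notin> laurent_over vmax"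
    using reduction_irrational[OF \<alpha>(1,2) frac qR q_red npR] by (simp add: poly_to_laurent_minus)
  then obtain b where b: "reduced_order (\<alpha> * ?q + ?p) b" using ex_reduced_order by blast
  have ord_\<alpha>q: "reduced_order (\<alpha> * ?q) (- int d + k)"
    by (rule reduced_order_mult[OF \<alpha>(1) qR \<alpha>(3) k])
  \<comment> \<open>At nonpositive orders \<open>p\<close> agrees with \<open>\<alpha> * ?q\<close>,
    so the conjugate factor cannot have smaller reduced order than
    \<open>\<alpha> * ?q\<close>.\<close>
  have b_ge: "- int d + k \<le> b"
  proof (rule reduced_order_ge[OF b])
    fix i assume i: "i < - int d + k"
    have "fls_nth (\<alpha> * ?q) i \<in> vmax" using ord_\<alpha>q i by (simp add: reduced_order_def)
    moreover have "fls_nth ?p i = fls_nth (\<alpha> * ?q) i" using p_eq i k_le by simp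
    ultimately show "fls_nth (\<alpha> * ?q + ?p) i \<in> vmax"
      using vmax_add by (metis fls_plus_nth)
  qed
  have "reduced_order ((\<alpha> * ?q - ?p) * (\<alpha> * ?q + ?p)) (a + b)"
    by (intro reduced_order_mult a b vring.laurent_over_diff vring.laurent_over_add \<alpha>q pR)
  moreover have "(\<alpha> * ?q - ?p) * (\<alpha> * ?q + ?p) = \<alpha> ^ 2 * ?q ^ 2 - ?p ^ 2"
    by (simp add: power2_eq_square algebra_simps)
  moreover have "\<dots> = poly_to_laurent (D * q ^ 2 - p ^ 2)"
    using \<alpha>(2) by (simp add: poly_to_laurent_diff poly_to_laurent_mult poly_to_laurent_power)
  ultimately have ord: "reduced_order (poly_to_laurent (D * q ^ 2 - p ^ 2)) (a + b)" by simp
  \<comment> \<open>A polynomial with nonzero reduction has reduced order at most 0. Together with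
    the lower bounds for \<open>a\<close> and \<open>b\<close> this bounds the reduced degree
    \<open>- k\<close> from below.\<close>
  have "a + b \<le> 0"
  proof (rule ccontr)
    assume "\<not> a + b \<le> 0"
    thus False using ord by (simp add: reduced_order_def poly_to_laurent_nth)
  qed
  hence bound: "int N + 1 \<le> int d - k" using a_ge b_ge by simp
  show ?thesis
  proof
    show "poly.coeff q (nat (- k)) \<notin> vmax" using k_coeff k_le by (simp add: poly_to_laurent_nth)
    show "N + 1 \<le> nat (- k) + d" using bound k_le by simp
    fix i assume "nat (- k) < i"
    hence "- int i < k" by simp
    hence "fls_nth ?q (- int i) \<in> vmax" using k by (auto simp: reduced_order_def)
    thus "poly.coeff q i \<in> vmax" by (simp add: poly_to_laurent_nth)
  qed
qed

text \<open>
  The elimination step of Chevalley's extension theorem: the higher degree of \<open>F\<close> and \<open>G\<close> is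
  lowered, in \<open>F\<close> by cancelling its leading term, in \<open>G\<close> by cancelling its constant term and dividing
  by the variable. It replaces an extension of the valuation to the field generated by \<open>x\<close>.
\<close>
lemma no_common_root:
  assumes "\<And>i. poly.coeff G i \<in> vring" "Polynomial.lead_coeff G \<notin> vmax"
    and "poly.coeff F 0 \<in> vring" "poly.coeff F 0 \<notin> vmax" "\<And>i. 0 < i \<Longrightarrow> poly.coeff F i \<in> vmax"
    and "poly G x = 0" "poly F x = 0"
  shows False
  using assms
proof (induction "Polynomial.degree F + Polynomial.degree G" arbitrary: F G rule: less_induct)
  case less
  define n m where "n = Polynomial.degree F" and "m = Polynomial.degree G"
  have FR: "poly.coeff F i \<in> vring" for i
    using less.prems(3,5) vmax_imp_vring by (cases i) auto
  have x_nz: "x \<noteq> 0" using less.prems(4,7) by (auto simp: poly_0_coeff_0)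
  have F0: "poly.coeff F 0 \<noteq> 0" and G_nz: "poly.coeff G m \<noteq> 0"
    using less.prems(2,4) by (auto simp: m_def)
  have n_pos: "n > 0"
  proof (rule ccontr)
    assume "\<not> n > 0"
    then obtain c where "F = [:c:]" unfolding n_def by (auto elim: degree_eq_zeroE)
    thus False using F0 less.prems(7) by simp
  qed
  show False
  proof (cases "n \<ge> m")
    case True
    define c where "c = poly.coeff F n / poly.coeff G m"
    \<comment> \<open>Since \<open>n > 0\<close>, the leading coefficient of \<open>F\<close> lies
      in \<open>vmax\<close>, so the correction leaves \<open>F\<close> congruent to a unit
      constant.\<close>
    have c: "c \<in> vmax"
      unfolding c_def using less.prems(1,2,5) n_pos by (intro vmax_divide_unit) (auto simp: m_def)
    define F' where "F' = F - smult c (Polynomial.monom 1 (n - m) * G)"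
    have coeff_F': "poly.coeff F' i = poly.coeff F i - c * (if n - m \<le> i then poly.coeff G (i - (n - m)) else 0)" for i
      by (simp add: F'_def coeff_monom_mult)
    have small: "poly.coeff F i - poly.coeff F' i \<in> vmax" for i
      using c less.prems(1) by (simp add: coeff_F' vmax_mult_right)
    have "Polynomial.degree F' < n"
    proof (rule degree_lessI)
      have "poly.coeff F' i = 0" if "i \<ge> n" for i
        using True G_nz that by (cases "i = n") (auto simp: coeff_F' c_def n_def m_def coeff_eq_0)
      thus "\<forall>i\<ge>n. poly.coeff F' i = 0" by blast
    qed (use n_pos in simp)
    hence dec: "Polynomial.degree F' + Polynomial.degree G < Polynomial.degree F + Polynomial.degree G"
      by (simp add: n_def)
    show False
    proof (rule less.hyps[OF dec less.prems(1,2)])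
      show "poly.coeff F' 0 \<in> vring"
        using vring.diff_closed[OF FR vmax_imp_vring[OF small], of 0 0] by simp
      show "poly.coeff F' 0 \<notin> vmax"
        using vmax_diff_cancel[OF small[of 0] less.prems(4)] by simp
      show "poly.coeff F' i \<in> vmax" if "0 < i" for i
        using vmax_diff[OF less.prems(5)[OF that] small[of i]] by simp
      show "poly G x = 0" "poly F' x = 0"
        using less.prems(6,7) by (simp_all add: F'_def)
    qed
  next
    case False
    \<comment> \<open>This cancels the constant term of \<open>G\<close>. As \<open>F\<close> has
      degree below \<open>m\<close>, the leading coefficient of \<open>G\<close> survives the
      division by the variable.\<close>
    define c where "c = poly.coeff G 0 / poly.coeff F 0"
    have c: "c \<in> vring"
      unfolding c_def using less.prems by (intro vring_divide_unit) auto
    define G' where "G' = poly_shift 1 (G - smult c F)"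
    have coeff_G': "poly.coeff G' i = poly.coeff G (i + 1) - c * poly.coeff F (i + 1)" for i
      by (simp add: G'_def coeff_poly_shift)
    have G'_eq: "pCons 0 G' = G - smult c F"
      using F0 by (intro poly_eqI) (auto simp: coeff_pCons coeff_G' c_def split: nat.splits)
    have deg: "Polynomial.degree G' = m - 1"
    proof (rule antisym)
      show "Polynomial.degree G' \<le> m - 1"
        by (rule degree_le) (use False in \<open>auto simp: coeff_G' n_def m_def coeff_eq_0\<close>)
      show "m - 1 \<le> Polynomial.degree G'"
        by (rule le_degree) (use False G_nz in \<open>auto simp: coeff_G' n_def coeff_eq_0\<close>)
    qed
    hence dec: "Polynomial.degree F + Polynomial.degree G' < Polynomial.degree F + Polynomial.degree G"
      using False by (simp add: m_def)
    show False
    proof (rule less.hyps[OF dec _ _ less.prems(3,4,5)])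
      show "poly.coeff G' i \<in> vring" for i
        unfolding coeff_G' using c FR less.prems(1) by (intro vring.diff_closed vring.mult_closed)
      show "Polynomial.lead_coeff G' \<notin> vmax"
        using False less.prems(2) by (simp add: deg coeff_G' n_def m_def coeff_eq_0)
      have "x * poly G' x = poly (pCons 0 G') x" by simp
      also have "\<dots> = 0" unfolding G'_eq using less.prems(6,7) by simp
      finally show "poly G' x = 0" using x_nz by simp
    qed (use less.prems(7) in auto)
  qed
qed

text \<open>A root \<open>l\<close> of \<open>q\<close> would be a common root of \<open>F\<close>,
  congruent to 1 modulo \<open>vmax\<close>, and of an integral \<open>G\<close> with unit leading
  coefficient, which \<open>no_common_root\<close> excludes. This stands for comparing the
  valuations of the terms of \<open>q\<close> at \<open>l\<close>.\<close>

lemma no_root_at_root_of_uniformizer: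
  assumes \<pi>: "uniformizer K \<nu> \<pi>" and l: "l ^ r = 1 / \<pi>"
    and q: "\<And>i. poly.coeff q i \<in> vring" "poly.coeff q j \<notin> vmax" "\<And>i. j < i \<Longrightarrow> poly.coeff q i \<in> vmax"
    and r: "Polynomial.degree q < j + r" "r > 0"
  shows "poly q l \<noteq> 0"
proof
  assume root: "poly q l = 0"
  have \<pi>K: "\<pi> \<in> K" "\<pi> \<noteq> 0" "\<nu> \<pi> = 1" using \<pi> by (auto simp: uniformizer_def)
  have div: "c / \<pi> \<in> vring" if "c \<in> vmax" for c
    using that \<pi>K
    by (auto simp: vmax_def vring_def divide_inverse val_mult val_inverse mult_closed inverse_closed)
  \<comment> \<open>\<open>G\<close> arises from \<open>X\<^sup>r q\<close> by replacing \<open>X\<^sup>r\<close> with \<open>1 / \<pi>\<close> in the terms above degree \<open>j + r\<close>.\<close>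
  define L where "L = poly_cutoff (j + 1) q"
  define G where "G = Polynomial.monom 1 r * L + smult (1 / \<pi>) (q - L)"
  define F where "F = 1 - Polynomial.monom \<pi> r"
  have coeff_G: "poly.coeff G i = (if r \<le> i \<and> i \<le> j + r then poly.coeff q (i - r) else 0)
      + (if j < i then poly.coeff q i / \<pi> else 0)" for i
    by (auto simp: G_def L_def coeff_monom_mult coeff_poly_cutoff)
  \<comment> \<open>The bound on the degree of \<open>q\<close> keeps the terms divided by
    \<open>\<pi>\<close> below degree \<open>j + r\<close>, so they do not touch the leading
    coefficient.\<close>
  have top: "poly.coeff G (j + r) = poly.coeff q j"
    using r by (simp add: coeff_G coeff_eq_0)
  have "poly.coeff q j \<noteq> 0" using q(2) by auto
  hence deg: "Polynomial.degree G = j + r"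
    using top r by (intro antisym degree_le le_degree) (auto simp: coeff_G coeff_eq_0)
  show False
  proof (rule no_common_root[of G F l])
    show "poly.coeff G i \<in> vring" for i
      unfolding coeff_G using q div by (intro vring.add_closed) (auto simp: vring.zero_closed)
    show "Polynomial.lead_coeff G \<notin> vmax" using q(2) by (simp add: deg top)
    show "poly.coeff F 0 \<in> vring" "poly.coeff F 0 \<notin> vmax"
      using r by (simp_all add: F_def vring.one_closed)
    show "poly.coeff F i \<in> vmax" if "0 < i" for i
      using that \<pi>K by (auto simp: F_def coeff_1 vmax_def val_minus uminus_closed zero_closed)
    have "poly G l = l ^ r * poly L l + 1 / \<pi> * (poly q l - poly L l)"
      by (simp add: G_def poly_monom)
    thus "poly G l = 0" by (simp add: l root)
    show "poly F l = 0" using l \<pi>K by (simp add: F_def poly_monom)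
  qed
qed

end

subsection \<open>Finiteness of the set of valuations at which an element is not a unit\<close>

context subfield_set
begin

lemma discretely_valued_fieldI: "discrete_valuation K \<nu> \<Longrightarrow> discretely_valued_field K \<nu>"
  by unfold_locales

text \<open>Otherwise positivity of \<open>\<mu>\<close> forces \<open>\<nu>\<close> to be
  nonnegative. Then units of \<open>\<mu>\<close> are units of \<open>\<nu>\<close>, so
  \<open>\<nu>\<close> is a constant multiple of \<open>\<mu>\<close>, and surjectivity onto the
  integers makes the constant 1.\<close>

lemma discrete_valuation_separation:
  assumes \<nu>: "discrete_valuation K \<nu>" and \<mu>: "discrete_valuation K \<mu>" and neq: "\<nu> \<noteq> \<mu>"
  shows "\<exists>x\<in>K. x \<noteq> 0 \<and> \<nu> x < 0 \<and> \<mu> x > 0"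
proof (rule ccontr)
  assume contra: "\<not> ?thesis"
  interpret N: discretely_valued_field K \<nu> using \<nu> by (rule discretely_valued_fieldI)
  interpret M: discretely_valued_field K \<mu> using \<mu> by (rule discretely_valued_fieldI)
  have dom: "\<nu> x \<ge> 0" if "x \<in> K" "x \<noteq> 0" "\<mu> x > 0" for x
    using contra that by (meson not_le)
  obtain t where t: "t \<in> K" "t \<noteq> 0" "\<mu> t = 1" using M.val_surj by blast
  have nonneg: "\<nu> y \<ge> 0" if y: "y \<in> K" "y \<noteq> 0" "\<mu> y = 0" for y
  proof (rule ccontr)
    assume "\<not> \<nu> y \<ge> 0"
    \<comment> \<open>With this exponent \<open>y ^ k * t\<close> has value 1 under
      \<open>\<mu>\<close> but a negative value under \<open>\<nu>\<close>.\<close>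
    define k where "k = nat (\<nu> t + 1)"
    have "\<nu> t \<ge> 0" using dom t by simp
    have "0 \<le> \<nu> (y ^ k * t)"
      using y t by (intro dom) (simp_all add: mult_closed power_closed M.val_mult M.val_power)
    also have "\<dots> = (\<nu> t + 1) * \<nu> y + \<nu> t"
      using y t \<open>\<nu> t \<ge> 0\<close> by (simp add: N.val_mult N.val_power power_closed k_def)
    also have "\<dots> \<le> (\<nu> t + 1) * (- 1) + \<nu> t"
      using \<open>\<not> \<nu> y \<ge> 0\<close> \<open>\<nu> t \<ge> 0\<close> by (intro add_right_mono mult_left_mono) auto
    finally show False by simp
  qed
  have zero: "\<nu> y = 0" if y: "y \<in> K" "y \<noteq> 0" "\<mu> y = 0" for y
    using nonneg[of y] nonneg[of "inverse y"] y
    by (simp add: inverse_closed M.val_inverse N.val_inverse)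
  have pow: "\<nu> x = \<mu> x * \<nu> t" if x: "x \<in> K" "x \<noteq> 0" for x
  proof (cases "\<mu> x \<ge> 0")
    case True
    have "\<nu> (x * inverse (t ^ nat (\<mu> x))) = 0"
      using x t True
      by (intro zero)
        (simp_all add: mult_closed inverse_closed power_closed M.val_mult M.val_inverse M.val_power)
    thus ?thesis
      using x t True
      by (simp add: inverse_closed power_closed N.val_mult N.val_inverse N.val_power)
  next
    case False
    have "\<nu> (x * t ^ nat (- \<mu> x)) = 0"
      using x t False
      by (intro zero) (simp_all add: mult_closed power_closed M.val_mult M.val_power)
    thus ?thesis
      using x t False by (simp add: power_closed N.val_mult N.val_power)
  qed
  obtain u where u: "u \<in> K" "u \<noteq> 0" "\<nu> u = 1" using N.val_surj by blast
  have "\<nu> t dvd 1" using pow[OF u(1,2)] u(3) by (metis dvd_triv_right)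
  moreover have "\<nu> t \<ge> 0" using dom t by simp
  ultimately have "\<nu> t = 1" by simp
  hence "\<nu> x = \<mu> x" if "x \<in> K - {0}" for x using pow that by simp
  \<comment> \<open>Extensionality turns agreement on the nonzero elements of \<open>K\<close> into
    equality of functions.\<close>
  moreover have "\<nu> \<in> extensional (K - {0})" "\<mu> \<in> extensional (K - {0})"
    using \<nu> \<mu> by (simp_all add: discrete_valuation_def)
  ultimately have "\<nu> = \<mu>" by (rule extensionalityI[rotated 2])
  thus False using neq by simp
qed

text \<open>Let \<open>x\<close> serve \<open>V\<close> and \<open>y\<close> separate
  \<open>\<nu>\<close> from the new \<open>\<mu>\<close>. If \<open>x\<close> fails at
  \<open>\<mu>\<close>, the inverse of \<open>a + b\<close>, with \<open>a\<close> the inverse of a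
  high power of \<open>x\<close> and \<open>b\<close> the inverse of \<open>y\<close>, serves both:
  \<open>a\<close> dominates on \<open>V\<close>, \<open>b\<close> dominates at
  \<open>\<mu>\<close>, and at \<open>\<nu>\<close> both have positive value.\<close>

lemma weak_approximation:
  assumes "finite V" "V \<subseteq> {\<mu>. discrete_valuation K \<mu>}" "discrete_valuation K \<nu>" "\<nu> \<notin> V"
  shows "\<exists>x\<in>K. x \<noteq> 0 \<and> \<nu> x < 0 \<and> (\<forall>\<mu>\<in>V. \<mu> x > 0)"
  using assms(1,2,4)
proof (induction V rule: finite_induct)
  case empty
  interpret N: discretely_valued_field K \<nu> using assms(3) by (rule discretely_valued_fieldI)
  show ?case using N.val_surj[of "- 1"] by auto
next
  case (insert \<mu> V)
  interpret N: discretely_valued_field K \<nu> using assms(3) by (rule discretely_valued_fieldI)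
  interpret M: discretely_valued_field K \<mu> using insert.prems by (auto intro: discretely_valued_fieldI)
  obtain x where x: "x \<in> K" "x \<noteq> 0" "\<nu> x < 0" "\<forall>\<kappa>\<in>V. \<kappa> x > 0"
    using insert by auto
  obtain y where y: "y \<in> K" "y \<noteq> 0" "\<nu> y < 0" "\<mu> y > 0"
    using discrete_valuation_separation[OF assms(3) M.valuation] insert.prems by auto
  show ?case
  proof (cases "\<mu> x > 0")
    case True
    thus ?thesis using x by auto
  next
    case False
    \<comment> \<open>Each value of \<open>x\<close> on \<open>V\<close> is at least 1, so an
      exponent above every value of \<open>y\<close> suffices; inserting 0 covers an empty
      \<open>V\<close>.\<close>
    define k where "k = Suc (nat (Max (insert 0 ((\<lambda>\<kappa>. \<kappa> y) ` V))))"
    have k_pos: "int k > 0" by (simp add: k_def)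
    have k: "\<kappa> y < int k * \<kappa> x" if "\<kappa> \<in> V" for \<kappa>
    proof -
      have "\<kappa> y \<le> Max (insert 0 ((\<lambda>\<kappa>. \<kappa> y) ` V))"
        using that insert.hyps by (intro Max_ge) auto
      hence "\<kappa> y < int k" unfolding k_def by linarith
      also have "\<dots> \<le> int k * \<kappa> x" using x(4) that by (auto simp: mult_le_cancel_left1 dest: bspec)
      finally show ?thesis .
    qed
    define a b where "a = inverse (x ^ k)" and "b = inverse y"
    have a: "a \<in> K" "a \<noteq> 0" and b: "b \<in> K" "b \<noteq> 0"
      using x y by (simp_all add: a_def b_def inverse_closed power_closed)
    have val_a: "\<kappa> a = - int k * \<kappa> x" and val_b: "\<kappa> b = - \<kappa> y"
      if "discrete_valuation K \<kappa>" for \<kappa>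
    proof -
      interpret J: discretely_valued_field K \<kappa> using that by (rule discretely_valued_fieldI)
      show "\<kappa> a = - int k * \<kappa> x" "\<kappa> b = - \<kappa> y"
        using x y by (simp_all add: a_def b_def J.val_inverse J.val_power power_closed)
    qed
    have "int k * \<mu> x \<le> 0" using False by (intro mult_nonneg_nonpos) auto
    hence "b + a \<noteq> 0 \<and> \<mu> (b + a) = \<mu> b"
      using M.val_add_less[OF b(1) a(1) b(2) a(2)] val_a[OF M.valuation] val_b[OF M.valuation]
        y(4) by simp
    hence nz: "a + b \<noteq> 0" and \<mu>: "\<mu> (a + b) < 0"
      using val_b[OF M.valuation] y(4) by (simp_all add: add.commute)
    have "\<kappa> (a + b) < 0" if \<kappa>V: "\<kappa> \<in> V" for \<kappa>
    proof -
      have \<kappa>: "discrete_valuation K \<kappa>" using insert.prems \<kappa>V by auto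
      interpret J: discretely_valued_field K \<kappa> using \<kappa> by (rule discretely_valued_fieldI)
      have "\<kappa> a < 0" using x(4) \<kappa>V k_pos by (simp add: val_a[OF \<kappa>])
      thus ?thesis
        using J.val_add_less[OF a(1) b(1) a(2) b(2)] k[OF \<kappa>V]
        by (simp add: val_a[OF \<kappa>] val_b[OF \<kappa>])
    qed
    moreover have "\<nu> (a + b) > 0"
    proof -
      have "\<nu> a > 0" "\<nu> b > 0"
        using x(3) y(3) k_pos by (simp_all add: val_a[OF assms(3)] val_b[OF assms(3)] mult_less_0_iff)
      thus ?thesis using N.val_add[OF a(1) b(1) a(2) b(2) nz] by simp
    qed
    moreover have "\<kappa> (inverse (a + b)) = - \<kappa> (a + b)" if "discrete_valuation K \<kappa>" for \<kappa>
    proof -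
      interpret J: discretely_valued_field K \<kappa> using that by (rule discretely_valued_fieldI)
      show ?thesis using nz a b by (simp add: J.val_inverse add_closed)
    qed
    ultimately have "\<nu> (inverse (a + b)) < 0" "\<mu> (inverse (a + b)) > 0"
        "\<forall>\<kappa>\<in>V. \<kappa> (inverse (a + b)) > 0"
      using \<mu> assms(3) M.valuation insert.prems by (metis neg_0_less_iff_less neg_less_0_iff_less
          insert_subset mem_Collect_eq subsetD)+
    thus ?thesis
      using nz a b by (intro bexI[of _ "inverse (a + b)"]) (auto simp: add_closed inverse_closed)
  qed
qed

end

section \<open>Rational linear relations and integers in valuation rings\<close>

interpretation rat_space: vector_space "\<lambda>(c::rat) (x::'a::field_char_0). of_rat c * x"
  by unfold_locales (simp_all add: algebra_simps of_rat_add of_rat_mult)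

text \<open>A common denominator is cleared and the gcd of the resulting integers divided out, after
  which \<open>p\<close> cannot divide all of them.\<close>

lemma rat_family_primitive:
  fixes f :: "'b \<Rightarrow> rat" and p :: int
  assumes fin: "finite S" and nz: "\<exists>x\<in>S. f x \<noteq> 0" and p: "prime p"
  obtains c :: rat and h :: "'b \<Rightarrow> int"
  where "c \<noteq> 0" "\<And>x. x \<in> S \<Longrightarrow> f x = c * of_int (h x)" "\<exists>x\<in>S. \<not> p dvd h x"
proof -
  have "\<exists>N>0. \<forall>x\<in>S. \<exists>g::int. rat_of_int N * f x = of_int g"
    using fin
  proof (induction S rule: finite_induct)
    case empty
    show ?case by (auto intro: exI[of _ 1])
  next
    case (insert y S)
    then obtain N where N: "N > 0" "\<forall>x\<in>S. \<exists>g::int. rat_of_int N * f x = of_int g" by blast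
    obtain a b where ab: "b > 0" "f y = of_int a / of_int b"
      by (metis quotient_of_denom_pos quotient_of_div surj_pair)
    have "\<exists>g::int. rat_of_int (N * b) * f x = of_int g" if x: "x \<in> insert y S" for x
    proof (cases "x = y")
      case True
      have "rat_of_int (N * b) * f x = of_int (N * a)" using ab True by simp
      thus ?thesis by blast
    next
      case False
      then obtain g where "rat_of_int N * f x = of_int g" using N(2) x by blast
      hence "rat_of_int (N * b) * f x = of_int (g * b)" by (simp add: algebra_simps)
      thus ?thesis by blast
    qed
    thus ?case using N(1) ab(1) by (intro exI[of _ "N * b"]) auto
  qed
  then obtain N where N: "N > 0" "\<forall>x\<in>S. \<exists>g::int. rat_of_int N * f x = of_int g" by blast
  then obtain g :: "'b \<Rightarrow> int" where g: "\<And>x. x \<in> S \<Longrightarrow> rat_of_int N * f x = of_int (g x)" by metis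
  define d where "d = Gcd (g ` S)"
  define h where "h = (\<lambda>x. g x div d)"
  obtain y where y: "y \<in> S" "f y \<noteq> 0" using nz by blast
  have "g y \<noteq> 0" using g[OF y(1)] y(2) N(1) by auto
  hence d_nz: "d \<noteq> 0" using y(1) by (auto simp: d_def Gcd_0_iff)
  have gh: "g x = d * h x" if "x \<in> S" for x
    using that by (simp add: h_def d_def)
  have "\<exists>x\<in>S. \<not> p dvd h x"
  proof (rule ccontr)
    assume "\<not> ?thesis"
    hence "d * p dvd g x" if "x \<in> S" for x using that gh by simp
    hence "d * p dvd d" unfolding d_def by (intro Gcd_greatest) auto
    hence "p dvd 1" using d_nz by simp
    thus False using p not_prime_unit by blast
  qed
  moreover have "f x = of_int d / of_int N * of_int (h x)" if "x \<in> S" for x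
    using g[OF that] gh[OF that] N(1) by (simp add: field_simps)
  ultimately show ?thesis
    using d_nz N(1) by (intro that[of "of_int d / of_int N" h]) auto
qed

context discretely_valued_field
begin

text \<open>By Bezout, two coprime integers in \<open>vmax\<close> would put 1 there.\<close>

lemma of_int_not_vmax:
  assumes "of_int p \<in> vmax" "prime p" "\<not> p dvd a"
  shows "of_int a \<notin> vmax"
proof
  assume a: "of_int a \<in> vmax"
  have "coprime p a" using assms by (simp add: prime_imp_coprime)
  then obtain u w where "u * p + w * a = 1" by (metis bezout_int coprime_imp_gcd_eq_1)
  hence "(of_int u :: 'a) * of_int p + of_int w * of_int a = 1"
    by (metis of_int_1 of_int_add of_int_mult)
  moreover have "(of_int u :: 'a) * of_int p + of_int w * of_int a \<in> vmax"
    by (intro vmax_add vmax_mult_left vring.of_int_closed a assms)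
  ultimately show False by simp
qed

lemma of_int_vmax_imp_prime:
  assumes "of_int a \<in> vmax" "a \<noteq> 0"
  shows "\<exists>p. prime p \<and> p dvd a \<and> of_int p \<in> vmax"
  using assms(2,1)
proof (induction a rule: prime_divisors_induct)
  case zero
  then show ?case by simp
next
  case (unit u)
  then obtain w where "u * w = 1" by (metis dvdE)
  hence "(of_int u :: 'a) * of_int w = 1" by (metis of_int_1 of_int_mult)
  thus ?case using vmax_mult_right[OF unit(3) vring.of_int_closed[of w]] by simp
next
  case (factor p a)
  then consider "of_int p \<in> vmax" | "of_int a \<in> vmax"
    using vmax_prime[of "of_int p" "of_int a"] by (auto simp: vring.of_int_closed)
  then show ?case
  proof cases
    case 1
    with factor.hyps(1) show ?thesis by (blast intro: dvd_triv_left)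
  next
    case 2
    moreover have "a \<noteq> 0" using factor.prems(1) by auto
    ultimately show ?thesis using factor.IH by (blast intro: dvd_mult)
  qed
qed

text \<open>For \<open>x\<close> in \<open>vmax\<close> the equation would make the constant term a
  multiple of \<open>x\<close> with integral cofactor.\<close>

lemma root_not_vmax:
  assumes "\<And>i. poly.coeff P i \<in> vring" "poly.coeff P 0 \<notin> vmax" "poly P x = 0"
  shows "x \<notin> vmax"
proof
  assume x: "x \<in> vmax"
  obtain c Q where P: "P = pCons c Q" by (cases P)
  have Q: "poly.coeff Q i \<in> vring" for i using assms(1)[of "Suc i"] P by simp
  have "poly Q x \<in> vring"
    unfolding poly_altdef
    by (intro vring.sum_closed vring.mult_closed vring.power_closed vmax_imp_vring x Q)
  hence "x * poly Q x \<in> vmax" by (rule vmax_mult_right[OF x])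
  moreover have "c = - (x * poly Q x)" using assms(3) P by (simp add: add_eq_0_iff)
  ultimately show False using assms(2) P vmax_uminus by auto
qed

end

section \<open>Valuations of a number field\<close>

locale number_field = subfield_set K for K :: "'a::field_char_0 set" +
  fixes B :: "'a set"
  assumes finite_generators: "finite B" and span: "K \<subseteq> rat_space.span B"
begin

text \<open>For a finite set \<open>G\<close> of such valuations, each \<open>\<nu>\<close> gets an
  \<open>x \<nu>\<close> with a pole at \<open>\<nu>\<close> and zeros at the others. Scale a
  rational relation to integers not all divisible by \<open>p\<close>: at a \<open>\<nu>\<close>
  whose coefficient is prime to \<open>p\<close>, its own term has negative value and all others lie
  in the maximal ideal. So the \<open>x \<nu>\<close> are independent and \<open>card B\<close>
  bounds \<open>card G\<close>.\<close>

lemma finite_valuations_over_prime: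
  assumes p: "prime p"
  shows "finite {\<nu>. discrete_valuation K \<nu> \<and> \<nu> (of_int p) > 0}"
proof -
  let ?V = "{\<nu>. discrete_valuation K \<nu> \<and> \<nu> (of_int p) > 0}"
  have "card G \<le> card B" if G: "G \<subseteq> ?V" "finite G" for G
  proof -
    have "\<exists>x\<in>K. x \<noteq> 0 \<and> \<nu> x < 0 \<and> (\<forall>\<mu>\<in>G - {\<nu>}. \<mu> x > 0)" if "\<nu> \<in> G" for \<nu>
      using G that by (intro weak_approximation) auto
    then obtain x where x: "\<And>\<nu>. \<nu> \<in> G \<Longrightarrow> x \<nu> \<in> K \<and> x \<nu> \<noteq> 0 \<and> \<nu> (x \<nu>) < 0"
        "\<And>\<nu> \<mu>. \<nu> \<in> G \<Longrightarrow> \<mu> \<in> G \<Longrightarrow> \<mu> \<noteq> \<nu> \<Longrightarrow> \<mu> (x \<nu>) > 0"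
      by (metis DiffI singletonD)
    have inj: "inj_on x G"
      by (rule inj_onI) (metis x not_less_iff_gr_or_eq)
    have "rat_space.independent (x ` G)"
    proof (rule rat_space.independent_if_scalars_zero)
      fix f y
      assume sum0: "(\<Sum>y\<in>x ` G. of_rat (f y) * y) = 0" and y: "y \<in> x ` G"
      show "f y = 0"
      proof (rule ccontr)
        assume "f y \<noteq> 0"
        hence ex: "\<exists>\<nu>\<in>G. f (x \<nu>) \<noteq> 0" using y by auto
        obtain c h where c: "c \<noteq> 0" and h: "\<And>\<nu>. \<nu> \<in> G \<Longrightarrow> f (x \<nu>) = c * of_int (h \<nu>)"
            "\<exists>\<nu>\<in>G. \<not> p dvd h \<nu>"
          using rat_family_primitive[OF G(2) ex p] by blast
        obtain \<nu> where \<nu>: "\<nu> \<in> G" "\<not> p dvd h \<nu>" using h(2) by blast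
        interpret N: discretely_valued_field K \<nu>
          using G \<nu>(1) by (intro discretely_valued_fieldI) auto
        have "(\<Sum>\<mu>\<in>G. of_rat (f (x \<mu>)) * x \<mu>) = 0"
          using sum0 by (simp add: sum.reindex[OF inj])
        also have "(\<Sum>\<mu>\<in>G. of_rat (f (x \<mu>)) * x \<mu>) = of_rat c * (\<Sum>\<mu>\<in>G. of_int (h \<mu>) * x \<mu>)"
          by (simp add: sum_distrib_left h(1) of_rat_mult mult.assoc)
        finally have "(\<Sum>\<mu>\<in>G. of_int (h \<mu>) * x \<mu>) = 0" using c by simp
        hence "of_int (h \<nu>) * x \<nu> = - (\<Sum>\<mu>\<in>G - {\<nu>}. of_int (h \<mu>) * x \<mu>)"
          using G(2) \<nu>(1) by (simp add: sum.remove[of G \<nu>] add_eq_0_iff2)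
        also have "\<dots> \<in> N.vmax"
          using x \<nu>(1)
          by (intro N.vmax_uminus N.vmax_sum N.vmax_mult_left N.vring.of_int_closed)
            (auto simp: N.vmax_def)
        finally have small: "of_int (h \<nu>) * x \<nu> \<in> N.vmax" .
        \<comment> \<open>Lying above \<open>p\<close> turns indivisibility by \<open>p\<close> into
          being a unit at \<open>\<nu>\<close>.\<close>
        have "of_int p \<in> N.vmax" using G \<nu>(1) by (auto simp: N.vmax_def of_int_closed)
        hence "of_int (h \<nu>) \<notin> N.vmax" by (rule N.of_int_not_vmax[OF _ p \<nu>(2)])
        hence "\<nu> (of_int (h \<nu>)) = 0" "of_int (h \<nu>) \<noteq> (0 :: 'a)"
          using N.unit_iff[of "of_int (h \<nu>)"] N.vring.of_int_closed by auto
        thus False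
          using small x(1)[OF \<nu>(1)] by (auto simp: N.vmax_def N.val_mult of_int_closed)
      qed
    qed (use G in auto)
    moreover have "x ` G \<subseteq> rat_space.span B" using x(1) span by blast
    ultimately have "card (x ` G) \<le> card B"
      using rat_space.independent_span_bound[OF finite_generators] by blast
    thus ?thesis by (simp add: card_image[OF inj])
  qed
  thus ?thesis using finite_if_finite_subsets_card_bdd[of ?V "card B"] by blast
qed

text \<open>Integers are integral at every valuation, so a non-unit \<open>a\<close> lies in the
  maximal ideal, which then contains one of its finitely many prime divisors.\<close>

lemma finite_valuations_of_int:
  assumes "a \<noteq> 0"
  shows "finite {\<nu>. discrete_valuation K \<nu> \<and> \<nu> (of_int a) \<noteq> 0}"
proof (rule finite_subset)
  show "finite (\<Union>p\<in>{p. prime p \<and> p dvd a}. {\<nu>. discrete_valuation K \<nu> \<and> \<nu> (of_int p) > 0})"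
    using assms finite_divisors_int[of a]
    by (intro finite_UN_I finite_valuations_over_prime) (auto elim!: finite_subset[rotated])
  show "{\<nu>. discrete_valuation K \<nu> \<and> \<nu> (of_int a) \<noteq> 0} \<subseteq>
      (\<Union>p\<in>{p. prime p \<and> p dvd a}. {\<nu>. discrete_valuation K \<nu> \<and> \<nu> (of_int p) > 0})"
  proof clarify
    fix \<nu> assume \<nu>: "discrete_valuation K \<nu>" "\<nu> (of_int a) \<noteq> 0"
    interpret N: discretely_valued_field K \<nu> using \<nu>(1) by (rule discretely_valued_fieldI)
    have "of_int a \<in> N.vmax"
      using N.unit_iff[of "of_int a"] N.vring.of_int_closed[of a] \<nu>(2) assms by auto
    then obtain p where "prime p" "p dvd a" "of_int p \<in> N.vmax"
      using N.of_int_vmax_imp_prime assms by blast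
    thus "\<nu> \<in> (\<Union>p\<in>{p. prime p \<and> p dvd a}. {\<nu>. discrete_valuation K \<nu> \<and> \<nu> (of_int p) > 0})"
      using \<nu>(1) by (auto simp: N.vmax_def prime_gt_0_int)
  qed
qed

lemma of_rat_closed: "of_rat c \<in> K"
  by (cases c) (simp add: of_rat_rat divide_closed of_int_closed)

lemma finite_valuations_of_rat:
  assumes "c \<noteq> 0"
  shows "finite {\<nu>. discrete_valuation K \<nu> \<and> \<nu> (of_rat c) \<noteq> 0}"
proof -
  obtain a b where ab: "c = Rat.Fract a b" "b > 0" by (cases c) auto
  hence nz: "a \<noteq> 0" "b \<noteq> 0" using assms by (auto simp: rat_number_collapse)
  show ?thesis
  proof (rule finite_subset)
    show "finite ({\<nu>. discrete_valuation K \<nu> \<and> \<nu> (of_int a) \<noteq> 0} \<union>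
        {\<nu>. discrete_valuation K \<nu> \<and> \<nu> (of_int b) \<noteq> 0})"
      using nz by (simp add: finite_valuations_of_int)
    show "{\<nu>. discrete_valuation K \<nu> \<and> \<nu> (of_rat c) \<noteq> 0} \<subseteq>
        {\<nu>. discrete_valuation K \<nu> \<and> \<nu> (of_int a) \<noteq> 0} \<union>
        {\<nu>. discrete_valuation K \<nu> \<and> \<nu> (of_int b) \<noteq> 0}"
    proof clarify
      fix \<nu> assume \<nu>: "discrete_valuation K \<nu>" "\<nu> (of_rat c) \<noteq> 0" "\<nu> (of_int b) = 0"
        and "\<nu> (of_int a) = 0"
      interpret N: discretely_valued_field K \<nu> using \<nu>(1) by (rule discretely_valued_fieldI)
      have "of_rat c = (of_int a * inverse (of_int b) :: 'a)"
        using nz by (simp add: ab(1) of_rat_rat divide_inverse)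
      also have "\<nu> \<dots> = \<nu> (of_int a) + - \<nu> (of_int b)"
        using nz by (subst N.val_mult)
          (simp_all add: N.val_inverse of_int_closed inverse_closed)
      finally have "\<nu> (of_rat c) = \<nu> (of_int a) + - \<nu> (of_int b)" .
      thus False using \<nu> \<open>\<nu> (of_int a) = 0\<close> by simp
    qed
  qed
qed

text \<open>Where all nonzero coefficients of \<open>P\<close> are units, both \<open>P\<close> and
  its reflection are integral with unit constant term, so their roots \<open>x\<close> and
  \<open>inverse x\<close> avoid the maximal ideal.\<close>

lemma finite_valuations_nonzero:
  assumes x: "x \<in> K" "x \<noteq> 0"
    and P: "poly.coeff P 0 \<noteq> 0" "poly (map_poly of_rat P) x = 0"
  shows "finite {\<nu>. discrete_valuation K \<nu> \<and> \<nu> x \<noteq> 0}"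
proof (rule finite_subset)
  let ?U = "\<Union>c\<in>set (coeffs P) - {0}. {\<nu>. discrete_valuation K \<nu> \<and> \<nu> (of_rat c) \<noteq> 0}"
  show "finite ?U" by (auto intro: finite_valuations_of_rat)
  show "{\<nu>. discrete_valuation K \<nu> \<and> \<nu> x \<noteq> 0} \<subseteq> ?U"
  proof (rule subsetI, rule ccontr)
    fix \<nu> assume "\<nu> \<in> {\<nu>. discrete_valuation K \<nu> \<and> \<nu> x \<noteq> 0}" and notin: "\<nu> \<notin> ?U"
    hence \<nu>: "discrete_valuation K \<nu>" "\<nu> x \<noteq> 0" by auto
    interpret N: discretely_valued_field K \<nu> using \<nu>(1) by (rule discretely_valued_fieldI)
    let ?P = "map_poly of_rat P :: 'a poly"
    have coeff_P: "poly.coeff ?P i = of_rat (poly.coeff P i)" for i by (simp add: coeff_map_poly)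
    have val: "\<nu> (poly.coeff ?P i) = 0" if "poly.coeff P i \<noteq> 0" for i
    proof -
      have "P \<noteq> 0" using that by auto
      hence "poly.coeff P i \<in> set (coeffs P)"
        using le_degree[OF that] by (rule coeff_in_coeffs)
      thus ?thesis using notin \<nu>(1) that by (auto simp: coeff_P)
    qed
    have PR: "poly.coeff ?P i \<in> N.vring" for i
      using val[of i]
      by (cases "poly.coeff P i = 0") (auto simp: coeff_P N.vring_def of_rat_closed zero_closed)
    have unit: "poly.coeff ?P i \<notin> N.vmax" if "poly.coeff P i \<noteq> 0" for i
      using val[OF that] that by (simp add: coeff_P N.vmax_def)
    have P_nz: "P \<noteq> 0" using P(1) by auto
    have "x \<notin> N.vmax"
      by (rule N.root_not_vmax[OF PR unit[OF P(1)] P(2)])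
    moreover have "inverse x \<notin> N.vmax"
    proof (rule N.root_not_vmax[of "reflect_poly ?P"])
      show "poly.coeff (reflect_poly ?P) i \<in> N.vring" for i
        using PR by (simp add: coeff_reflect_poly N.vring.zero_closed)
      show "poly.coeff (reflect_poly ?P) 0 \<notin> N.vmax"
        using unit[of "Polynomial.degree P"] P_nz by (simp add: degree_map_poly)
      show "poly (reflect_poly ?P) (inverse x) = 0"
        using P(2) x by (simp add: poly_reflect_poly_nz)
    qed
    ultimately show False
      using x \<nu>(2) by (auto simp: N.vmax_def N.val_inverse inverse_closed)
  qed
qed

end

subsection \<open>Finitely generated subfields of algebraic closures of the rationals\<close>

lemma ring_of_type_algebra_simps:
  "\<zero>\<^bsub>ring_of_type_algebra\<^esub> = (0 :: 'a::field)"
  "\<one>\<^bsub>ring_of_type_algebra\<^esub> = (1 :: 'a)"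
  "x \<oplus>\<^bsub>ring_of_type_algebra\<^esub> y = (x + y :: 'a)"
  "x \<otimes>\<^bsub>ring_of_type_algebra\<^esub> y = (x * y :: 'a)"
  by (simp_all add: ring_of_type_algebra_def)

lemma ring_of_type_algebra_a_inv: "\<ominus>\<^bsub>ring_of_type_algebra\<^esub> x = (- x :: 'a::field)"
proof -
  interpret ring "ring_of_type_algebra :: 'a ring" by (rule ring_from_type_algebra)
  show ?thesis
    by (rule minus_equality) (simp_all add: ring_of_type_algebra_def)
qed

lemma ring_of_type_algebra_m_inv:
  "x \<noteq> 0 \<Longrightarrow> inv\<^bsub>ring_of_type_algebra\<^esub> x = (inverse x :: 'a::field)"
proof -
  interpret ring "ring_of_type_algebra :: 'a ring" by (rule ring_from_type_algebra)
  show "x \<noteq> 0 \<Longrightarrow> ?thesis"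
    by (rule inv_char) (simp_all add: ring_of_type_algebra_def)
qed

lemmas ring_of_type_algebra_ops =
  ring_of_type_algebra_simps ring_of_type_algebra_a_inv ring_of_type_algebra_m_inv

lemma subfield_set_generate_field:
  fixes H :: "'a::field set"
  shows "subfield_set (generate_field ring_of_type_algebra H)"
proof -
  let ?F = "generate_field (ring_of_type_algebra :: 'a ring) H"
  have add: "x + y \<in> ?F" if "x \<in> ?F" "y \<in> ?F" for x y
    using generate_field.eng_add[OF that] by (simp add: ring_of_type_algebra_ops)
  have one: "1 \<in> ?F"
    using generate_field.one[of "ring_of_type_algebra :: 'a ring" H]
    by (simp add: ring_of_type_algebra_ops)
  have uminus: "- x \<in> ?F" if "x \<in> ?F" for x
    using generate_field.a_inv[OF that] by (simp add: ring_of_type_algebra_ops)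
  have inverse: "inverse x \<in> ?F" if "x \<in> ?F" for x
  proof (cases "x = 0")
    case True
    then show ?thesis using add[OF one uminus[OF one]] by simp
  next
    case False
    then show ?thesis
      using generate_field.m_inv[OF that] by (simp add: ring_of_type_algebra_ops)
  qed
  have mult: "x * y \<in> ?F" if "x \<in> ?F" "y \<in> ?F" for x y
    using generate_field.eng_mult[OF that] by (simp add: ring_of_type_algebra_ops)
  show ?thesis
    by unfold_locales (simp_all add: one add uminus mult inverse)
qed

lemma generate_field_least:
  fixes H :: "'a::field set"
  assumes "subfield_set L" "H \<subseteq> L"
  shows "generate_field ring_of_type_algebra H \<subseteq> L"
proof
  interpret subfield_set L by fact
  fix x assume "x \<in> generate_field ring_of_type_algebra H"
  thus "x \<in> L"
    by (induction rule: generate_field.induct)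
      (use assms(2) in \<open>auto simp: ring_of_type_algebra_ops
        intro: add_closed mult_closed uminus_closed inverse_closed one_closed\<close>)
qed

text \<open>Factors of the variable can be removed from \<open>P\<close> because \<open>x\<close> is
  nonzero.\<close>

lemma rat_algebraic_nonzero_const:
  fixes x :: "'a::field_char_0"
  assumes "P \<noteq> 0" "poly (map_poly of_rat P) x = 0" "x \<noteq> 0"
  shows "\<exists>Q. poly.coeff Q 0 \<noteq> 0 \<and> poly (map_poly of_rat Q) x = 0"
  using assms
proof (induction P)
  case (pCons c P)
  show ?case
  proof (cases "c = 0")
    case True
    then show ?thesis using pCons by (auto simp: map_poly_pCons)
  next
    case False
    then show ?thesis using pCons by (intro exI[of _ "pCons c P"]) auto
  qed
qed simp

lemma to_ac_rat: "to_ac (c :: rat) = of_rat c"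
  by (cases c) (simp add: Fract_of_int_quotient of_rat_divide)

lemma qbar_algebraic:
  fixes x :: qbar
  obtains P where "P \<noteq> 0" "poly (map_poly of_rat P) x = 0"
  using alg_closure_algebraic[of x] by (metis to_ac_rat map_poly_cong)

text \<open>An algebraic equation with nonzero constant term expresses \<open>inverse x\<close> as a
  polynomial in \<open>x\<close> with rational coefficients.\<close>

lemma subfield_set_of_subring:
  fixes L :: "'a::field_char_0 set"
  assumes "subring_set L" "\<rat> \<subseteq> L"
    and alg: "\<And>x. x \<in> L \<Longrightarrow> \<exists>P. P \<noteq> 0 \<and> poly (map_poly of_rat P) x = 0"
  shows "subfield_set L"
proof -
  interpret subring_set L by fact
  show ?thesis
  proof
    fix x assume x: "x \<in> L"
    show "inverse x \<in> L"
    proof (cases "x = 0")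
      case False
      obtain Q where Q: "poly.coeff Q 0 \<noteq> 0" "poly (map_poly of_rat Q) x = 0"
        using alg[OF x] rat_algebraic_nonzero_const False by blast
      obtain c R where QR: "Q = pCons c R" by (cases Q)
      have c: "c \<noteq> 0" using Q(1) QR by simp
      let ?R = "map_poly of_rat R :: 'a poly"
      have "of_rat c + x * poly ?R x = 0"
        using Q(2) c by (simp add: QR map_poly_pCons)
      hence "x * poly ?R x = - of_rat c" by (simp add: add_eq_0_iff)
      hence "x * (of_rat (- inverse c) * poly ?R x) = of_rat (- inverse c) * - of_rat c"
        by (simp only: mult.left_commute[of x])
      also have "\<dots> = 1" using c by (simp add: of_rat_minus of_rat_inverse)
      finally have inv: "inverse x = of_rat (- inverse c) * poly ?R x" by (rule inverse_unique)
      have "poly ?R x \<in> L"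
        unfolding poly_altdef using assms(2) x
        by (intro sum_closed mult_closed power_closed) (auto simp: coeff_map_poly)
      hence "of_rat (- inverse c) * poly ?R x \<in> L"
        using assms(2) by (intro mult_closed) auto
      thus ?thesis by (simp only: inv)
    qed (simp add: zero_closed)
  qed
qed

text \<open>The ring \<open>L'\<close> is L[x]. Reducing powers of \<open>x\<close> by
  \<open>P\<close> leaves the products \<open>b * x ^ i\<close> with \<open>i\<close> below the
  degree of \<open>P\<close> as generators.\<close>

lemma adjoin_algebraic_finite:
  fixes x :: "'a::field_char_0"
  assumes "subring_set L" "L \<subseteq> rat_space.span B" "finite B"
    and P: "P \<noteq> 0" "poly (map_poly of_rat P) x = 0"
  shows "\<exists>L' B'. subring_set L' \<and> insert x L \<subseteq> L' \<and> L' \<subseteq> rat_space.span B' \<and> finite B'"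
proof -
  interpret subring_set L by fact
  define n where "n = Polynomial.degree P"
  define L' where "L' = {poly Q x | Q. \<forall>i. poly.coeff Q i \<in> L}"
  define B' where "B' = (\<lambda>(b, i). b * x ^ i) ` (B \<times> {..<n})"
  have n: "n > 0"
  proof (rule ccontr)
    assume "\<not> n > 0"
    then obtain c where "P = [:c:]" unfolding n_def by (auto elim: degree_eq_zeroE)
    thus False using P by (simp add: map_poly_pCons)
  qed
  have "subring_set L'"
  proof
    show "1 \<in> L'" unfolding L'_def
      by (rule CollectI, rule exI[of _ 1]) (simp add: coeff_1 zero_closed one_closed)
    fix y assume "y \<in> L'"
    then obtain Q where Q: "y = poly Q x" "\<forall>i. poly.coeff Q i \<in> L" by (auto simp: L'_def)
    show "- y \<in> L'" unfolding L'_def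
      by (rule CollectI, rule exI[of _ "- Q"]) (simp add: Q uminus_closed)
    fix z assume "z \<in> L'"
    then obtain R where R: "z = poly R x" "\<forall>i. poly.coeff R i \<in> L" by (auto simp: L'_def)
    show "y + z \<in> L'" unfolding L'_def
      by (rule CollectI, rule exI[of _ "Q + R"]) (simp add: Q R add_closed)
    show "y * z \<in> L'" unfolding L'_def
      by (rule CollectI, rule exI[of _ "Q * R"]) (simp add: Q R coeff_mult_closed)
  qed
  moreover have "insert x L \<subseteq> L'"
  proof
    fix y assume "y \<in> insert x L"
    thus "y \<in> L'"
    proof
      assume "y = x"
      thus ?thesis unfolding L'_def
        by (intro CollectI exI[of _ "[:0, 1:]"])
          (auto simp: coeff_pCons zero_closed one_closed split: nat.splits)
    next
      assume "y \<in> L"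
      thus ?thesis unfolding L'_def
        by (intro CollectI exI[of _ "[:y:]"]) (auto simp: coeff_pCons zero_closed split: nat.splits)
    qed
  qed
  moreover have "L' \<subseteq> rat_space.span B'"
  proof -
    have gen: "b * x ^ i \<in> rat_space.span B'" if "b \<in> B" "i < n" for b i
      using that by (intro rat_space.span_base) (auto simp: B'_def)
    \<comment> \<open>Only the top power overflows, and the equation for \<open>x\<close> rewrites
      it by lower ones. Stability under \<open>x\<close> suffices, since polynomials are then
      evaluated by Horner's scheme.\<close>
    have mult_x: "x * v \<in> rat_space.span B'" if "v \<in> rat_space.span B'" for v
      using that
    proof (induction rule: rat_space.span_induct_alt)
      case base
      show ?case by (simp add: rat_space.span_zero)
    next
      case (step c v w)
      from step(1) obtain b i where bi: "b \<in> B" "i < n" "v = b * x ^ i" by (auto simp: B'_def)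
      have "x * v \<in> rat_space.span B'"
      proof (cases "Suc i < n")
        case True
        then show ?thesis using gen[of b "Suc i"] bi by (simp add: algebra_simps)
      next
        case False
        hence i: "Suc i = n" using bi by simp
        define l where "l = Polynomial.lead_coeff P"
        have l: "l \<noteq> 0" using P by (simp add: l_def)
        have "0 = (\<Sum>k\<le>n. of_rat (poly.coeff P k) * x ^ k)"
          using P(2) by (simp add: poly_altdef coeff_map_poly degree_map_poly n_def)
        also have "\<dots> = of_rat l * x ^ n + (\<Sum>k<n. of_rat (poly.coeff P k) * x ^ k)"
          by (simp add: l_def n_def lessThan_Suc_atMost[symmetric])
        finally have "of_rat l * x ^ n = - (\<Sum>k<n. of_rat (poly.coeff P k) * x ^ k)"
          by (simp add: add_eq_0_iff2)
        hence "of_rat (inverse l) * (of_rat l * x ^ n) =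
            of_rat (- inverse l) * (\<Sum>k<n. of_rat (poly.coeff P k) * x ^ k)"
          by (simp add: of_rat_minus)
        moreover have "of_rat (inverse l) * (of_rat l * x ^ n) = x ^ n"
          using l by (simp add: of_rat_inverse mult.assoc[symmetric])
        ultimately have "x ^ n = of_rat (- inverse l) * (\<Sum>k<n. of_rat (poly.coeff P k) * x ^ k)"
          by simp
        hence "b * x ^ n = of_rat (- inverse l) * (b * (\<Sum>k<n. of_rat (poly.coeff P k) * x ^ k))"
          by (simp only: mult.left_commute)
        also have "b * (\<Sum>k<n. of_rat (poly.coeff P k) * x ^ k) =
            (\<Sum>k<n. of_rat (poly.coeff P k) * (b * x ^ k))"
          by (simp add: sum_distrib_left mult.left_commute)
        also have "b * x ^ n = x * v"
          by (simp add: bi(3) i[symmetric] mult.left_commute)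
        finally have "x * v = of_rat (- inverse l) * (\<Sum>k<n. of_rat (poly.coeff P k) * (b * x ^ k))" .
        also have "\<dots> \<in> rat_space.span B'"
          by (intro rat_space.span_scale rat_space.span_sum gen bi) auto
        finally show ?thesis .
      qed
      hence "of_rat c * (x * v) + x * w \<in> rat_space.span B'"
        using step by (intro rat_space.span_add rat_space.span_scale)
      thus ?case by (simp add: algebra_simps)
    qed
    have B_sub: "rat_space.span B \<subseteq> rat_space.span B'"
      by (rule rat_space.span_minimal) (use gen[of _ 0] n in \<open>auto simp: rat_space.subspace_span\<close>)
    have "poly Q x \<in> rat_space.span B'" if "\<forall>i. poly.coeff Q i \<in> L" for Q
      using that
    proof (induction Q)
      case (pCons c Q)
      have "poly.coeff Q i \<in> L" for i using pCons.prems[rule_format, of "Suc i"] by simp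
      moreover have "c \<in> L" using pCons.prems[rule_format, of 0] by simp
      ultimately show ?case
        using pCons.IH assms(2) B_sub by (auto intro!: rat_space.span_add mult_x)
    qed (simp add: rat_space.span_zero)
    thus ?thesis by (auto simp: L'_def)
  qed
  moreover have "finite B'" using assms(3) by (simp add: B'_def)
  ultimately show ?thesis by blast
qed

lemma finite_rat_dimension:
  fixes S :: "'a::field_char_0 set"
  assumes "finite S" "\<And>x. x \<in> S \<Longrightarrow> \<exists>P. P \<noteq> 0 \<and> poly (map_poly of_rat P) x = 0"
  shows "\<exists>L B. subring_set L \<and> \<rat> \<union> S \<subseteq> L \<and> L \<subseteq> rat_space.span B \<and> finite B"
  using assms
proof (induction S rule: finite_induct)
  case empty
  have "subring_set (\<rat> :: 'a set)"
    by unfold_locales simp_all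
  moreover have "(\<rat> :: 'a set) \<subseteq> rat_space.span {1}"
  proof
    fix x :: 'a assume "x \<in> \<rat>"
    then obtain c where "x = of_rat c * 1" by (auto elim: Rats_cases)
    also have "\<dots> \<in> rat_space.span {1}" by (intro rat_space.span_scale rat_space.span_base) simp
    finally show "x \<in> rat_space.span {1}" .
  qed
  ultimately show ?case by (intro exI[of _ "\<rat>"] exI[of _ "{1}"]) simp
next
  case (insert x S)
  have "\<exists>L B. subring_set L \<and> \<rat> \<union> S \<subseteq> L \<and> L \<subseteq> rat_space.span B \<and> finite B"
    by (rule insert.IH) (use insert.prems in blast)
  then obtain L B where L: "subring_set L" "\<rat> \<union> S \<subseteq> L" "L \<subseteq> rat_space.span B" "finite B"
    by blast
  obtain P where "P \<noteq> 0" "poly (map_poly of_rat P) x = 0" using insert.prems by blast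
  from adjoin_algebraic_finite[OF L(1,3,4) this] show ?case using L(2) by blast
qed

text \<open>Adjoining the generators one at a time gives a ring of finite dimension. Its elements
  are algebraic, so it is a field and contains \<open>coeff_field D s\<close>.\<close>

lemma number_field_coeff_field: "\<exists>B. number_field (coeff_field D s) B"
proof -
  have "range (poly.coeff D) = insert 0 (set (coeffs D))" by (rule range_coeff)
  hence "finite (insert s (range (poly.coeff D)))" by simp
  moreover have alg: "\<exists>P. P \<noteq> 0 \<and> poly (map_poly of_rat P) x = 0" for x :: qbar
    by (rule qbar_algebraic) blast
  ultimately have "\<exists>L B. subring_set L \<and> \<rat> \<union> insert s (range (poly.coeff D)) \<subseteq> L \<and>
      L \<subseteq> rat_space.span B \<and> finite B"
    by (rule finite_rat_dimension)
  then obtain L B where L: "subring_set L" "\<rat> \<union> insert s (range (poly.coeff D)) \<subseteq> L"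
      "L \<subseteq> rat_space.span B" "finite B"
    by blast
  have "subfield_set L"
  proof (rule subfield_set_of_subring[OF L(1)])
    show "\<exists>P. P \<noteq> 0 \<and> poly (map_poly of_rat P) x = 0" for x :: qbar
      by (rule alg)
  qed (use L(2) in blast)
  hence "coeff_field D s \<subseteq> L"
    unfolding coeff_field_def using L(2) by (intro generate_field_least) auto
  moreover have "subfield_set (coeff_field D s)"
    unfolding coeff_field_def by (rule subfield_set_generate_field)
  ultimately have "number_field (coeff_field D s) B"
    using L by (auto simp: number_field_def number_field_axioms_def)
  thus ?thesis by blast
qed

subsection \<open>Denominators of convergents at roots of uniformizers\<close>

context discretely_valued_field
begin

text \<open>Divide by a coefficient of least value, taken among the nonzero ones since the value at
  0 is meaningless.\<close>

lemma primitive_multiple: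
  assumes q: "\<And>i. poly.coeff q i \<in> K" "q \<noteq> 0"
  obtains c where "c \<noteq> 0" "\<And>i. poly.coeff (smult c q) i \<in> vring"
    "\<exists>i. poly.coeff (smult c q) i \<notin> vmax"
proof -
  define C where "C = set (coeffs q) - {0}"
  have C: "a \<in> C \<longleftrightarrow> a \<noteq> 0 \<and> (\<exists>i. a = poly.coeff q i)" for a
    using range_coeff[of q] by (auto simp: C_def)
  have "Polynomial.lead_coeff q \<in> C" using q(2) by (auto simp: C)
  hence "finite (\<nu> ` C)" "\<nu> ` C \<noteq> {}" by (auto simp: C_def)
  hence "Min (\<nu> ` C) \<in> \<nu> ` C" by (rule Min_in)
  then obtain a where a: "a \<in> C" "\<nu> a = Min (\<nu> ` C)" by auto
  have min: "\<nu> a \<le> \<nu> b" if "b \<in> C" for b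
    unfolding a(2) using that by (simp add: C_def)
  have aK: "a \<in> K" "a \<noteq> 0" using a(1) q(1) by (auto simp: C)
  show ?thesis
  proof
    show "inverse a \<noteq> 0" using aK by simp
    show "poly.coeff (smult (inverse a) q) i \<in> vring" for i
    proof (cases "poly.coeff q i = 0")
      case False
      hence "\<nu> a \<le> \<nu> (poly.coeff q i)" by (intro min) (auto simp: C)
      thus ?thesis using False aK q(1)
        by (simp add: vring_def val_mult val_inverse inverse_closed mult_closed)
    qed (simp add: vring.zero_closed)
    obtain i where "a = poly.coeff q i" using a(1) C by blast
    thus "\<exists>i. poly.coeff (smult (inverse a) q) i \<notin> vmax"
      using aK by (intro exI[of _ i]) simp
  qed
qed

lemma convergent_den_nonzero_at_root:
  assumes two: "(2 :: 'a) \<noteq> 0" "\<nu> 2 = 0"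
    and D: "Polynomial.degree D = 2 * d" "d > 0" "\<And>i. poly.coeff D i \<in> vring"
    and s: "s ^ 2 = Polynomial.lead_coeff D" "s \<in> K" "\<nu> s = 0"
    and \<alpha>: "\<alpha> \<in> laurent_over K" "\<alpha> ^ 2 = poly_to_laurent D"
    and R: "poly.coeff (D - (poly_part \<alpha>) ^ 2) i \<notin> vmax"
    and \<pi>: "uniformizer K \<nu> \<pi>" and l: "l ^ r = 1 / \<pi>" and r: "r \<ge> d"
  shows "poly (convergent_den \<alpha> n) l \<noteq> 0"
proof -
  have D_nz: "D \<noteq> 0" using D by auto
  have s_nz: "s \<noteq> 0" using s(1) D_nz by auto
  have \<alpha>_nz: "\<alpha> \<noteq> 0"
  proof
    assume "\<alpha> = 0"
    hence "poly_to_laurent D = poly_to_laurent 0" using \<alpha>(2) by simp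
    thus False using D_nz by (simp only: poly_to_laurent_eq_iff)
  qed
  have "fls_subdegree (\<alpha> * \<alpha>) = - int (2 * d)"
    using subdegree_poly_to_laurent[OF D_nz] \<alpha>(2) D(1) by (simp add: power2_eq_square)
  hence subdeg: "fls_subdegree \<alpha> = - int d" using \<alpha>_nz by simp
  \<comment> \<open>The leading coefficient of \<open>\<alpha>\<close> is \<open>s\<close> or
    \<open>- s\<close>, depending on the chosen square root, and a unit either way.\<close>
  define a where "a = fls_nth \<alpha> (- int d)"
  have "a ^ 2 = fls_nth (\<alpha> ^ 2) (- int (2 * d))"
    by (simp add: a_def power2_eq_square fls_times_nth(2) subdeg)
  also have "\<dots> = s ^ 2"
    by (simp add: \<alpha>(2) poly_to_laurent_nth s(1) D(1) nat_mult_distrib)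
  finally have "a = s \<or> a = - s" by (simp add: power2_eq_iff)
  hence a: "a \<in> K" "a \<noteq> 0" "\<nu> a = 0" using s s_nz by (auto simp: uminus_closed val_minus)
  hence a_unit: "a \<in> vring" "a \<notin> vmax" using unit_iff by blast+
  have "(2 :: 'a) \<in> K" using of_nat_closed[of 2] by simp
  hence "inverse (2 * a) \<in> vring"
    using a two by (simp add: vring_def val_inverse val_mult mult_closed inverse_closed
        del: inverse_mult_distrib)
  hence \<alpha>R: "\<alpha> \<in> laurent_over vring"
    using a_unit two D(3)
    by (auto intro!: vring.laurent_over_sqrt[of \<alpha>]
        simp: \<alpha>(2) subdeg a_def[symmetric] vring.laurent_over_poly)
  have ord: "reduced_order \<alpha> (- int d)"
    using a_unit subdeg by (simp add: reduced_order_def a_def)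
  let ?A = "poly_to_laurent (poly_part \<alpha>)"
  have AR: "?A \<in> laurent_over vring"
    using vring.laurent_over_poly_part[OF \<alpha>R] by (simp add: vring.laurent_over_poly)
  \<comment> \<open>Multiplying by the integral series \<open>\<alpha> + ?A\<close> yields
    \<open>D - (poly_part \<alpha>) ^ 2\<close>, whose coefficient at \<open>i\<close> survives
    reduction.\<close>
  have frac: "\<alpha> - ?A \<notin> laurent_over vmax"
  proof
    assume "\<alpha> - ?A \<in> laurent_over vmax"
    hence "(\<alpha> + ?A) * (\<alpha> - ?A) \<in> laurent_over vmax"
      by (intro laurent_over_vmax_mult vring.laurent_over_add \<alpha>R AR)
    also have "(\<alpha> + ?A) * (\<alpha> - ?A) = \<alpha> ^ 2 - ?A ^ 2"
      by (simp add: power2_eq_square algebra_simps)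
    also have "\<dots> = poly_to_laurent (D - (poly_part \<alpha>) ^ 2)"
      by (simp add: \<alpha>(2) poly_to_laurent_diff poly_to_laurent_power)
    finally have "fls_nth (poly_to_laurent (D - (poly_part \<alpha>) ^ 2)) (- int i) \<in> vmax"
      by (simp add: laurent_over_def)
    thus False using R by (simp add: poly_to_laurent_nth)
  qed
  define e where "e = (\<lambda>n. \<alpha> * poly_to_laurent (continuant_q \<alpha> n) - poly_to_laurent (continuant_p \<alpha> n))"
  have scale: "\<alpha> * poly_to_laurent (smult c (continuant_q \<alpha> m)) -
      poly_to_laurent (smult c (continuant_p \<alpha> m)) = fls_const c * e m" for c m
    by (simp add: e_def poly_to_laurent_smult algebra_simps)
  \<comment> \<open>Irrationality of \<open>\<alpha>\<close> over \<open>K\<close> follows from that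
    of its reduction: an exact relation, scaled to a primitive denominator, would remain a relation
    modulo \<open>vmax\<close>.\<close>
  have irrational: "e m \<noteq> 0" if nz: "continuant_q \<alpha> m \<noteq> 0" for m
  proof
    assume e0: "e m = 0"
    obtain c where c: "\<And>i. poly.coeff (smult c (continuant_q \<alpha> m)) i \<in> vring"
        "\<exists>i. poly.coeff (smult c (continuant_q \<alpha> m)) i \<notin> vmax"
      using primitive_multiple[OF coeff_continuant_q_closed[OF \<alpha>(1)] nz] by metis
    let ?q = "poly_to_laurent (smult c (continuant_q \<alpha> m))"
      and ?p = "poly_to_laurent (smult c (continuant_p \<alpha> m))"
    have eq: "\<alpha> * ?q - ?p = 0" using scale[of c m] e0 by simp
    have qR: "?q \<in> laurent_over vring" using c(1) by (simp only: vring.laurent_over_poly) blast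
    have "?p = \<alpha> * ?q" using eq by simp
    hence pR: "?p \<in> laurent_over vring" using vring.laurent_over_mult[OF \<alpha>R qR] by simp
    obtain i where i: "poly.coeff (smult c (continuant_q \<alpha> m)) i \<notin> vmax" using c(2) by blast
    hence "fls_nth ?q (- int i) \<notin> vmax" by (simp add: poly_to_laurent_nth)
    hence "?q \<notin> laurent_over vmax" by (auto simp: laurent_over_def)
    from reduction_irrational[OF \<alpha>R \<alpha>(2) frac qR this pR] show False
      unfolding eq by (simp add: laurent_over_def)
  qed
  define q where "q = continuant_q \<alpha> (n + 2)"
  have neg: "fls_subdegree \<alpha> < 0" using subdeg D(2) by simp
  have q_nz: "q \<noteq> 0"
    unfolding q_def using convergent_error(1)[OF neg irrational[unfolded e_def]] .
  have e_deg: "fls_subdegree (e (n + 2)) > int (Polynomial.degree q)"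
    unfolding q_def e_def using convergent_error(2)[OF neg irrational[unfolded e_def]] .
  have qK: "poly.coeff q i \<in> K" for i
    unfolding q_def by (rule coeff_continuant_q_closed[OF \<alpha>(1)])
  obtain c where c: "c \<noteq> 0" "\<And>i. poly.coeff (smult c q) i \<in> vring"
      "\<exists>i. poly.coeff (smult c q) i \<notin> vmax"
    using primitive_multiple[OF qK q_nz] by metis
  \<comment> \<open>Scaling by the nonzero \<open>c\<close> changes neither the roots of
    \<open>q\<close> nor the order of the error, which exceeds the degree of
    \<open>q\<close>.\<close>
  have approx: "fls_nth (\<alpha> * poly_to_laurent (smult c q) -
      poly_to_laurent (smult c (continuant_p \<alpha> (n + 2)))) k = 0"
    if "k \<le> int (Polynomial.degree q)" for k
    unfolding q_def scale using that e_deg by simp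
  obtain j where j: "poly.coeff (smult c q) j \<notin> vmax"
      "\<And>i. j < i \<Longrightarrow> poly.coeff (smult c q) i \<in> vmax" "Polynomial.degree q + 1 \<le> j + d"
    using reduced_degree_bound[OF \<alpha>R \<alpha>(2) ord frac c(2,3) approx] by metis
  have "poly (smult c q) l \<noteq> 0"
    by (rule no_root_at_root_of_uniformizer[OF \<pi> l c(2) j(1,2)]) (use j(3) r D(2) c(1) in simp_all)
  thus ?thesis by (simp add: convergent_den_def q_def)
qed

end

theorem mainTheorem2:
  fixes D :: "qbar poly" and d :: nat and s :: qbar and K :: "qbar set" and \<alpha> :: "qbar fls"
  assumes "D \<in> S_qbar"
    and "Polynomial.degree D = 2 * d"
    and "s ^ 2 = Polynomial.lead_coeff D"
    and "K = coeff_field D s"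
    and "\<alpha> \<in> laurent_over K"
    and "\<alpha> ^ 2 = poly_to_laurent D"
  shows "\<exists>E. finite E \<and> E \<subseteq> {\<nu>. discrete_valuation K \<nu>} \<and>
           (\<forall>\<nu>. discrete_valuation K \<nu> \<and> \<nu> \<notin> E \<longrightarrow>
             (\<forall>\<pi>. uniformizer K \<nu> \<pi> \<longrightarrow>
               (\<forall>r::nat. r \<ge> d \<longrightarrow>
                 (\<forall>l::qbar. l ^ r = 1 / \<pi> \<longrightarrow>
                   (\<forall>n. Polynomial.poly (convergent_den \<alpha> n) l \<noteq> 0)))))"
proof -
  obtain B where "number_field K B"
    using number_field_coeff_field[of D s] assms(4) by blast
  then interpret number_field K B .
  have d: "d > 0" using assms(1,2) by (simp add: S_qbar_def)
  have sK: "s \<in> K"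
    unfolding assms(4) coeff_field_def by (intro generate_field.incl) simp
  have DK: "poly.coeff D i \<in> K" for i
    unfolding assms(4) coeff_field_def by (intro generate_field.incl) simp
  let ?R = "D - (poly_part \<alpha>) ^ 2"
  \<comment> \<open>Otherwise \<open>D\<close> would be the square of
    \<open>poly_part \<alpha>\<close>.\<close>
  have "?R \<noteq> 0" using assms(1) by (auto simp: S_qbar_def)
  then obtain i where i: "poly.coeff ?R i \<noteq> 0" by (metis leading_coeff_neq_0)
  have RK: "poly.coeff ?R i \<in> K"
    unfolding power2_eq_square coeff_diff
    by (intro diff_closed DK coeff_mult_closed laurent_over_poly_part assms(5))
  \<comment> \<open>Integrality of \<open>D\<close> is secured by asking its nonzero coefficients to
    be units, at the cost of finitely many more exceptions.\<close>
  define Z where "Z = {2, s, poly.coeff ?R i} \<union> set (coeffs D) - {0}"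
  have Z: "finite Z" "z \<in> Z \<Longrightarrow> z \<noteq> 0" "z \<in> Z \<Longrightarrow> z \<in> K" for z
    using sK RK DK of_nat_closed[of 2] range_coeff[of D] by (auto simp: Z_def)
  define E where "E = (\<Union>z\<in>Z. {\<nu>. discrete_valuation K \<nu> \<and> \<nu> z \<noteq> 0})"
  have "finite {\<nu>. discrete_valuation K \<nu> \<and> \<nu> z \<noteq> 0}" if zZ: "z \<in> Z" for z
  proof -
    obtain P where P: "P \<noteq> 0" "poly (map_poly of_rat P) z = 0" by (rule qbar_algebraic)
    obtain Q where "poly.coeff Q 0 \<noteq> 0" "poly (map_poly of_rat Q) z = 0"
      using rat_algebraic_nonzero_const[OF P Z(2)[OF zZ]] by blast
    thus ?thesis by (rule finite_valuations_nonzero[OF Z(3,2)[OF zZ]])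
  qed
  hence "finite E" using Z(1) by (simp add: E_def)
  have nonzero: "poly (convergent_den \<alpha> n) l \<noteq> 0"
    if \<nu>: "discrete_valuation K \<nu>" "\<nu> \<notin> E"
      and root: "uniformizer K \<nu> \<pi>" "r \<ge> d" "l ^ r = 1 / \<pi>" for \<nu> \<pi> r l n
  proof -
    interpret N: discretely_valued_field K \<nu> using \<nu>(1) by (rule discretely_valued_fieldI)
    have val: "\<nu> z = 0" if "z \<in> Z" for z using \<nu> that by (auto simp: E_def)
    show ?thesis
    proof (rule N.convergent_den_nonzero_at_root[where s = s and i = i])
      show "\<nu> 2 = 0" by (rule val) (simp add: Z_def)
      have "s \<noteq> 0" using assms(1,3) by (auto simp: S_qbar_def)
      thus "\<nu> s = 0" by (intro val) (simp add: Z_def)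
      have "\<nu> (poly.coeff ?R i) = 0" using i by (intro val) (simp add: Z_def)
      thus "poly.coeff ?R i \<notin> N.vmax" using i by (simp add: N.vmax_def)
      show "poly.coeff D k \<in> N.vring" for k
      proof (cases "poly.coeff D k = 0")
        case False
        hence "poly.coeff D k \<in> Z" using range_coeff[of D] by (auto simp: Z_def)
        thus ?thesis using val DK by (simp add: N.vring_def)
      qed (simp add: N.vring.zero_closed)
    qed (use assms d sK root in simp_all)
  qed
  show ?thesis
  proof (intro exI[of _ E] conjI allI impI)
    fix \<nu> \<pi> r l n
    assume "discrete_valuation K \<nu> \<and> \<nu> \<notin> E" "uniformizer K \<nu> \<pi>" "d \<le> r" "l ^ r = 1 / \<pi>"
    thus "poly (convergent_den \<alpha> n) l \<noteq> 0" by (elim conjE) (rule nonzero)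
  qed (fact \<open>finite E\<close>, auto simp: E_def)
qed

end
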